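(* Let $\mathcal{T}$ be a conformal infinitesimal bending with conformal factor $\rho\in C^\infty(M)$ of an isometric immersion $f\colon M^n\to\mathbb{R}^m$ with second fundamental form $\alpha$, and let $(\beta,\mathcal{E})$ be the pair of tensors associated to $\mathcal{T}$. Then for all $X,Y,Z\in\mathfrak{X}(M)$ and $\eta\in\Gamma(N_fM)$ the following equations hold: $$A_{\beta(Y,Z)}X+B_{\alpha(Y,Z)}X-A_{\beta(X,Z)}Y-B_{\alpha(X,Z)}Y+(X\wedge HY-Y\wedge HX)Z=0,$$ $$(\nabla^{\perp}_X\beta)(Y,Z)-(\nabla^{\perp}_Y\beta)(X,Z)=\mathcal{E}(Y,\alpha(X,Z))-\mathcal{E}(X,\alpha(Y,Z))+\langle Y,Z\rangle\alpha(X,\nabla\rho)-\langle X,Z\rangle\alpha(Y,\nabla\rho),$$ $$(\nabla^{\perp}_X\mathcal{E})(Y,\eta)-(\nabla^{\perp}_Y\mathcal{E})(X,\eta)=\beta(X,A_\eta Y)-\beta(A_\eta X,Y)+\alpha(X,B_\eta Y)-\alpha(B_\eta X,Y).$$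
   Context: $M^n$ is a Riemannian manifold with Levi-Civita connection $\nabla$; $\tilde\nabla$ is the flat connection of $\mathbb{R}^m$; $N_fM$ is the normal bundle of $f$ with normal connection $\nabla^\perp$; $(\cdot)_{N_fM}$ denotes the normal component. A conformal infinitesimal bending of $f$ with conformal factor $\rho$ is a smooth section $\mathcal{T}\in\Gamma(f^*T\mathbb{R}^m)$ with $\langle\tilde\nabla_X\mathcal{T},f_*Y\rangle+\langle f_*X,\tilde\nabla_Y\mathcal{T}\rangle=2\rho\langle X,Y\rangle$ for all $X,Y\in\mathfrak{X}(M)$. The associated pair $(\beta,\mathcal{E})$: put $LX=\tilde\nabla_X\mathcal{T}-\rho f_*X$ and define $\mathcal{Y}\colon N_fM\to TM$ by $\langle\mathcal{Y}\eta,X\rangle+\langle\eta,LX\rangle=0$. Then $\beta(X,Y)=(\tilde\nabla_XLY-L\nabla_XY)_{N_fM}$ (a symmetric tensor) and $\mathcal{E}(X,\eta)=\alpha(X,\mathcal{Y}\eta)+(LA_\eta X)_{N_fM}$. The endomorphisms $A_\eta,B_\eta,H$ of $TM$ are given by $\langle A_\eta X,Y\rangle=\langle\alpha(X,Y),\eta\rangle$, $\langle B_\eta X,Y\rangle=\langle\beta(X,Y),\eta\rangle$, $HX=\nabla_X\nabla\rho$, where $\nabla\rho$ is the gradient of $\rho$. The wedge convention is $(X\wedge Y)Z=\langle Y,Z\rangle X-\langle X,Z\rangle Y$. Covariant derivatives of $\beta$ and $\mathcal{E}$ are induced by $\nabla$ and $\nabla^\perp$, e.g. $(\nabla^\perp_X\mathcal{E})(Y,\eta)=\nabla^\perp_X\mathcal{E}(Y,\eta)-\mathcal{E}(\nabla_XY,\eta)-\mathcal{E}(Y,\nabla^\perp_X\eta)$.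 *)

theory Defs
  imports "HOL-Analysis.Analysis" "HOL-Library.Function_Algebras"
begin

section \<open>Smooth manifolds\<close>

primrec Ck_on :: "nat \<Rightarrow> 'a::real_normed_vector set \<Rightarrow> ('a \<Rightarrow> 'b::real_normed_vector) \<Rightarrow> bool" where
  "Ck_on 0 S F \<longleftrightarrow> continuous_on S F"
| "Ck_on (Suc k) S F \<longleftrightarrow>
     (\<forall>x\<in>S. F differentiable (at x)) \<and> (\<forall>w. Ck_on k S (\<lambda>x. frechet_derivative F (at x) w))"

definition smooth_on :: "'a::real_normed_vector set \<Rightarrow> ('a \<Rightarrow> 'b::real_normed_vector) \<Rightarrow> bool" where
  "smooth_on S F \<longleftrightarrow> (\<forall>k. Ck_on k S F)"

text \<open>The underlying space of the manifold is the whole type \<open>'a\<close>; a chart is a pair of its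
  domain and its coordinate map. An atlas need not be maximal.\<close>

type_synonym ('a, 'n) atlas = "('a set \<times> ('a \<Rightarrow> real ^ 'n)) set"

definition smooth_atlas :: "('a::{t2_space,second_countable_topology}, 'n::finite) atlas \<Rightarrow> bool" where
  "smooth_atlas M \<longleftrightarrow>
     (\<Union>(U, \<phi>)\<in>M. U) = UNIV \<and>
     (\<forall>(U, \<phi>)\<in>M. open U \<and> open (\<phi> ` U) \<and> homeomorphism U (\<phi> ` U) \<phi> (inv_into U \<phi>)) \<and>
     (\<forall>(U, \<phi>)\<in>M. \<forall>(V, \<psi>)\<in>M. smooth_on (\<phi> ` (U \<inter> V)) (\<psi> \<circ> inv_into U \<phi>))"

definition smooth_map :: "('a, 'n::finite) atlas \<Rightarrow> ('a \<Rightarrow> 'b::real_normed_vector) \<Rightarrow> bool" where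
  "smooth_map M F \<longleftrightarrow> (\<forall>(U, \<phi>)\<in>M. smooth_on (\<phi> ` U) (F \<circ> inv_into U \<phi>))"

text \<open>Tangent vectors are directional derivative operators on smooth functions. They are set to
  \<open>0\<close> on functions that are not smooth, so that equality of tangent vectors is equality of
  operators.\<close>

type_synonym 'a tvec = "('a \<Rightarrow> real) \<Rightarrow> real"
type_synonym 'a vfield = "'a \<Rightarrow> 'a tvec"

definition tangent_space :: "('a, 'n::finite) atlas \<Rightarrow> 'a \<Rightarrow> 'a tvec set" where
  "tangent_space M p =
     {v. \<exists>(U, \<phi>)\<in>M. p \<in> U \<and>
        (\<exists>w. v = (\<lambda>h. if smooth_map M h
                      then frechet_derivative (h \<circ> inv_into U \<phi>) (at (\<phi> p)) w else 0))}"

definition vector_fields :: "('a, 'n::finite) atlas \<Rightarrow> 'a vfield set" where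
  "vector_fields M =
     {X. (\<forall>p. X p \<in> tangent_space M p) \<and>
         (\<forall>h. smooth_map M h \<longrightarrow> smooth_map M (\<lambda>p. X p h))}"

definition fmult :: "('a \<Rightarrow> real) \<Rightarrow> 'a vfield \<Rightarrow> 'a vfield" where
  "fmult c X = (\<lambda>p h. c p * X p h)"

definition sec_mult :: "('a \<Rightarrow> real) \<Rightarrow> ('a \<Rightarrow> real ^ 'm) \<Rightarrow> ('a \<Rightarrow> real ^ 'm)" where
  "sec_mult c V = (\<lambda>p. c p *\<^sub>R V p)"

definition lie_bracket :: "'a vfield \<Rightarrow> 'a vfield \<Rightarrow> 'a vfield" where
  "lie_bracket X Y = (\<lambda>p h. X p (\<lambda>q. Y q h) - Y p (\<lambda>q. X q h))"


section \<open>Riemannian metrics and connections\<close>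

type_synonym 'a metric = "'a \<Rightarrow> 'a tvec \<Rightarrow> 'a tvec \<Rightarrow> real"

definition ip :: "'a metric \<Rightarrow> 'a vfield \<Rightarrow> 'a vfield \<Rightarrow> 'a \<Rightarrow> real" where
  "ip g X Y = (\<lambda>p. g p (X p) (Y p))"

definition riemannian_metric :: "('a, 'n::finite) atlas \<Rightarrow> 'a metric \<Rightarrow> bool" where
  "riemannian_metric M g \<longleftrightarrow>
     (\<forall>p. \<forall>u\<in>tangent_space M p. \<forall>v\<in>tangent_space M p.
        g p u v = g p v u \<and>
        (\<forall>w\<in>tangent_space M p. g p (u + v) w = g p u w + g p v w) \<and>
        (\<forall>c. g p (\<lambda>h. c * u h) v = c * g p u v) \<and>
        (u \<noteq> 0 \<longrightarrow> g p u u > 0)) \<and>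
     (\<forall>X\<in>vector_fields M. \<forall>Y\<in>vector_fields M. smooth_map M (ip g X Y))"

type_synonym 'a connection = "'a vfield \<Rightarrow> 'a vfield \<Rightarrow> 'a vfield"

definition affine_connection :: "('a, 'n::finite) atlas \<Rightarrow> 'a connection \<Rightarrow> bool" where
  "affine_connection M nab \<longleftrightarrow>
     (\<forall>X\<in>vector_fields M. \<forall>Y\<in>vector_fields M.
        nab X Y \<in> vector_fields M \<and>
        (\<forall>Z\<in>vector_fields M. nab (X + Y) Z = nab X Z + nab Y Z \<and>
                               nab X (Y + Z) = nab X Y + nab X Z) \<and>
        (\<forall>c. smooth_map M c \<longrightarrow>
           nab (fmult c X) Y = fmult c (nab X Y) \<and>
           nab X (fmult c Y) = fmult (\<lambda>p. X p c) Y + fmult c (nab X Y)))"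

definition levi_civita :: "('a, 'n::finite) atlas \<Rightarrow> 'a metric \<Rightarrow> 'a connection \<Rightarrow> bool" where
  "levi_civita M g nab \<longleftrightarrow>
     affine_connection M nab \<and>
     (\<forall>X\<in>vector_fields M. \<forall>Y\<in>vector_fields M. nab X Y - nab Y X = lie_bracket X Y) \<and>
     (\<forall>X\<in>vector_fields M. \<forall>Y\<in>vector_fields M. \<forall>Z\<in>vector_fields M. \<forall>p.
        X p (ip g Y Z) = ip g (nab X Y) Z p + ip g Y (nab X Z) p)"

definition gradient :: "('a, 'n::finite) atlas \<Rightarrow> 'a metric \<Rightarrow> ('a \<Rightarrow> real) \<Rightarrow> 'a vfield" where
  "gradient M g \<rho> =
     (THE W. W \<in> vector_fields M \<and> (\<forall>X\<in>vector_fields M. \<forall>p. ip g W X p = X p \<rho>))"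

definition wedge :: "'a metric \<Rightarrow> 'a vfield \<Rightarrow> 'a vfield \<Rightarrow> 'a vfield \<Rightarrow> 'a vfield" where
  "wedge g X Y Z = fmult (ip g Y Z) X - fmult (ip g X Z) Y"


section \<open>Isometric immersions into Euclidean space\<close>

text \<open>Sections of the pull-back bundle of the tangent bundle of Euclidean space along a map are
  identified with vector-valued functions on the manifold. Under this identification the flat
  connection differentiates each component, and the image of \<open>X\<close> under the differential of \<open>f\<close>
  is the derivative of \<open>f\<close> along \<open>X\<close>.\<close>

definition vderiv :: "'a tvec \<Rightarrow> ('a \<Rightarrow> real ^ 'm) \<Rightarrow> real ^ 'm" where
  "vderiv v V = (\<chi> i. v (\<lambda>q. V q $ i))"

definition flat_conn :: "'a vfield \<Rightarrow> ('a \<Rightarrow> real ^ 'm) \<Rightarrow> ('a \<Rightarrow> real ^ 'm)" where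
  "flat_conn X V = (\<lambda>p. vderiv (X p) V)"

definition push :: "('a \<Rightarrow> real ^ 'm) \<Rightarrow> 'a vfield \<Rightarrow> ('a \<Rightarrow> real ^ 'm)" where
  "push f X = (\<lambda>p. vderiv (X p) f)"

text \<open>Injectivity of the differential follows from positive definiteness of the metric.\<close>

definition isometric_immersion ::
    "('a, 'n::finite) atlas \<Rightarrow> 'a metric \<Rightarrow> ('a \<Rightarrow> real ^ 'm::finite) \<Rightarrow> bool" where
  "isometric_immersion M g f \<longleftrightarrow>
     smooth_map M f \<and>
     (\<forall>p. \<forall>u\<in>tangent_space M p. \<forall>v\<in>tangent_space M p. vderiv u f \<bullet> vderiv v f = g p u v)"

definition normal_space ::
    "('a, 'n::finite) atlas \<Rightarrow> ('a \<Rightarrow> real ^ 'm::finite) \<Rightarrow> 'a \<Rightarrow> (real ^ 'm) set" where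
  "normal_space M f p = {\<xi>. \<forall>v\<in>tangent_space M p. \<xi> \<bullet> vderiv v f = 0}"

definition normal_sections ::
    "('a, 'n::finite) atlas \<Rightarrow> ('a \<Rightarrow> real ^ 'm::finite) \<Rightarrow> ('a \<Rightarrow> real ^ 'm) set" where
  "normal_sections M f = {\<eta>. smooth_map M \<eta> \<and> (\<forall>p. \<eta> p \<in> normal_space M f p)}"

definition normal_part ::
    "('a, 'n::finite) atlas \<Rightarrow> ('a \<Rightarrow> real ^ 'm::finite) \<Rightarrow> ('a \<Rightarrow> real ^ 'm) \<Rightarrow> ('a \<Rightarrow> real ^ 'm)" where
  "normal_part M f V =
     (\<lambda>p. THE \<xi>. \<xi> \<in> normal_space M f p \<and> V p - \<xi> \<in> (\<lambda>v. vderiv v f) ` tangent_space M p)"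

definition second_ff ::
    "('a, 'n::finite) atlas \<Rightarrow> ('a \<Rightarrow> real ^ 'm::finite) \<Rightarrow> 'a vfield \<Rightarrow> 'a vfield \<Rightarrow> ('a \<Rightarrow> real ^ 'm)" where
  "second_ff M f X Y = normal_part M f (flat_conn X (push f Y))"

definition normal_conn ::
    "('a, 'n::finite) atlas \<Rightarrow> ('a \<Rightarrow> real ^ 'm::finite) \<Rightarrow> 'a vfield \<Rightarrow> ('a \<Rightarrow> real ^ 'm) \<Rightarrow> ('a \<Rightarrow> real ^ 'm)" where
  "normal_conn M f X \<eta> = normal_part M f (flat_conn X \<eta>)"

text \<open>The endomorphism of the tangent bundle determined by a normal-bundle-valued bilinear form
  \<open>b\<close> and a normal section \<open>\<eta>\<close>: this is \<open>A\<^sub>\<eta>\<close> for \<open>b = \<alpha>\<close> and \<open>B\<^sub>\<eta>\<close> for \<open>b = \<beta>\<close>.\<close>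

definition shape_op ::
    "('a, 'n::finite) atlas \<Rightarrow> 'a metric \<Rightarrow> ('a vfield \<Rightarrow> 'a vfield \<Rightarrow> 'a \<Rightarrow> real ^ 'm::finite) \<Rightarrow>
     ('a \<Rightarrow> real ^ 'm) \<Rightarrow> 'a vfield \<Rightarrow> 'a vfield" where
  "shape_op M g b \<eta> X =
     (THE W. W \<in> vector_fields M \<and> (\<forall>Y\<in>vector_fields M. \<forall>p. ip g W Y p = b X Y p \<bullet> \<eta> p))"


section \<open>Conformal infinitesimal bendings\<close>

definition conformal_bending ::
    "('a, 'n::finite) atlas \<Rightarrow> 'a metric \<Rightarrow> ('a \<Rightarrow> real ^ 'm::finite) \<Rightarrow> ('a \<Rightarrow> real) \<Rightarrow>
     ('a \<Rightarrow> real ^ 'm) \<Rightarrow> bool" where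
  "conformal_bending M g f \<rho> \<T> \<longleftrightarrow>
     smooth_map M \<rho> \<and> smooth_map M \<T> \<and>
     (\<forall>X\<in>vector_fields M. \<forall>Y\<in>vector_fields M. \<forall>p.
        flat_conn X \<T> p \<bullet> push f Y p + push f X p \<bullet> flat_conn Y \<T> p = 2 * \<rho> p * ip g X Y p)"

definition bend_L ::
    "('a \<Rightarrow> real ^ 'm::finite) \<Rightarrow> ('a \<Rightarrow> real) \<Rightarrow> ('a \<Rightarrow> real ^ 'm) \<Rightarrow> 'a vfield \<Rightarrow> ('a \<Rightarrow> real ^ 'm)" where
  "bend_L f \<rho> \<T> X = flat_conn X \<T> - sec_mult \<rho> (push f X)"

definition bend_Y ::
    "('a, 'n::finite) atlas \<Rightarrow> 'a metric \<Rightarrow> ('a \<Rightarrow> real ^ 'm::finite) \<Rightarrow> ('a \<Rightarrow> real) \<Rightarrow>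
     ('a \<Rightarrow> real ^ 'm) \<Rightarrow> ('a \<Rightarrow> real ^ 'm) \<Rightarrow> 'a vfield" where
  "bend_Y M g f \<rho> \<T> \<eta> =
     (THE W. W \<in> vector_fields M \<and>
        (\<forall>X\<in>vector_fields M. \<forall>p. ip g W X p + \<eta> p \<bullet> bend_L f \<rho> \<T> X p = 0))"

definition bend_beta ::
    "('a, 'n::finite) atlas \<Rightarrow> 'a connection \<Rightarrow> ('a \<Rightarrow> real ^ 'm::finite) \<Rightarrow> ('a \<Rightarrow> real) \<Rightarrow>
     ('a \<Rightarrow> real ^ 'm) \<Rightarrow> 'a vfield \<Rightarrow> 'a vfield \<Rightarrow> ('a \<Rightarrow> real ^ 'm)" where
  "bend_beta M nab f \<rho> \<T> X Y =
     normal_part M f (flat_conn X (bend_L f \<rho> \<T> Y) - bend_L f \<rho> \<T> (nab X Y))"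

definition bend_E ::
    "('a, 'n::finite) atlas \<Rightarrow> 'a metric \<Rightarrow> ('a \<Rightarrow> real ^ 'm::finite) \<Rightarrow> ('a \<Rightarrow> real) \<Rightarrow>
     ('a \<Rightarrow> real ^ 'm) \<Rightarrow> 'a vfield \<Rightarrow> ('a \<Rightarrow> real ^ 'm) \<Rightarrow> ('a \<Rightarrow> real ^ 'm)" where
  "bend_E M g f \<rho> \<T> X \<eta> =
     second_ff M f X (bend_Y M g f \<rho> \<T> \<eta>) +
     normal_part M f (bend_L f \<rho> \<T> (shape_op M g (second_ff M f) \<eta> X))"

definition cov_deriv_form ::
    "('a, 'n::finite) atlas \<Rightarrow> 'a connection \<Rightarrow> ('a \<Rightarrow> real ^ 'm::finite) \<Rightarrow>
     ('a vfield \<Rightarrow> 'a vfield \<Rightarrow> 'a \<Rightarrow> real ^ 'm) \<Rightarrow>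
     'a vfield \<Rightarrow> 'a vfield \<Rightarrow> 'a vfield \<Rightarrow> ('a \<Rightarrow> real ^ 'm)" where
  "cov_deriv_form M nab f b X Y Z =
     normal_conn M f X (b Y Z) - b (nab X Y) Z - b Y (nab X Z)"

definition cov_deriv_mixed ::
    "('a, 'n::finite) atlas \<Rightarrow> 'a connection \<Rightarrow> ('a \<Rightarrow> real ^ 'm::finite) \<Rightarrow>
     ('a vfield \<Rightarrow> ('a \<Rightarrow> real ^ 'm) \<Rightarrow> 'a \<Rightarrow> real ^ 'm) \<Rightarrow>
     'a vfield \<Rightarrow> 'a vfield \<Rightarrow> ('a \<Rightarrow> real ^ 'm) \<Rightarrow> ('a \<Rightarrow> real ^ 'm)" where
  "cov_deriv_mixed M nab f e X Y \<eta> =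
     normal_conn M f X (e Y \<eta>) - e (nab X Y) \<eta> - e Y (normal_conn M f X \<eta>)"

end

theory Submission imports Defs
begin

text \<open>Write \<open>D\<close> for the flat connection, identify \<open>X\<close> with \<open>f\<^sub>*X\<close>, and let \<open>\<nabla>\<rho>\<close> be the gradient of the conformal
  factor. Skewness of \<open>(X, Y) \<mapsto> \<langle>L X, Y\<rangle>\<close> and flatness of \<open>D\<close> force, by a Koszul-type argument,
  \<open>D\<^sub>X L Y = L \<nabla>\<^sub>X Y + \<beta>(X, Y) + \<Y> \<alpha>(X, Y) + Y(\<rho>) X - \<langle>X, Y\<rangle> \<nabla>\<rho>\<close>,
  and from this
  \<open>D\<^sub>X \<Y> \<eta> = \<Y> \<nabla>\<^sup>\<bottom>\<^sub>X \<eta> - L A\<^sub>\<eta> X + \<E>(X, \<eta>) - B\<^sub>\<eta> X\<close>.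
  Since \<open>D\<close> is flat and \<open>\<nabla>\<close> is torsion free, the second derivative \<open>D\<^sub>X D\<^sub>Y V - D\<^bsub>\<nabla> X Y\<^esub> V\<close> is symmetric in
  \<open>X\<close> and \<open>Y\<close>. For \<open>V = L Z\<close>, after removing the terms that are symmetric by the Gauss and Codazzi
  equations, the tangential and normal parts of this symmetry are the first two equations; the normal
  part for \<open>V = \<Y> \<eta>\<close> is the third.\<close>

section \<open>Calculus of finitely often differentiable functions\<close>

text \<open>\<open>Ck_on\<close> uses derivatives on full neighbourhoods. On an open set, agreement
  at a point is agreement nearby, so the derivatives agree and the induction passes to them.\<close>

lemma Ck_on_cong:
  assumes "open S" "\<And>x. x \<in> S \<Longrightarrow> F x = G x" "Ck_on k S F"
  shows "Ck_on k S G"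
  using assms(2,3)
proof (induction k arbitrary: F G)
  case 0
  then show ?case by (simp cong: continuous_on_cong)
next
  case (Suc k)
  have D: "(G has_derivative frechet_derivative F (at x)) (at x)" if "x \<in> S" for x
  proof -
    have "(F has_derivative frechet_derivative F (at x)) (at x)"
      using Suc.prems(2) that by (simp add: frechet_derivative_works)
    then show ?thesis
      by (rule has_derivative_transform_within_open[OF _ \<open>open S\<close> that]) (use Suc.prems in auto)
  qed
  have "Ck_on k S (\<lambda>x. frechet_derivative G (at x) w)" for w
    by (rule Suc.IH[of "\<lambda>x. frechet_derivative F (at x) w"])
       (use Suc.prems frechet_derivative_at[OF D] in auto)
  then show ?case using D by (auto simp: differentiable_def)
qed

text \<open>Derivatives at a point are unique, so an explicit \<open>F'\<close> may stand for
  \<open>frechet_derivative\<close> and the usual differentiation rules become applicable.\<close>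

lemma Ck_on_SucI:
  assumes "open S"
    and D: "\<And>x. x \<in> S \<Longrightarrow> (F has_derivative F' x) (at x)"
    and "\<And>w. Ck_on k S (\<lambda>x. F' x w)"
  shows "Ck_on (Suc k) S F"
proof -
  have "Ck_on k S (\<lambda>x. frechet_derivative F (at x) w)" for w
    by (rule Ck_on_cong[OF \<open>open S\<close> _ assms(3)[of w]]) (use frechet_derivative_at[OF D] in auto)
  then show ?thesis using D by (auto simp: differentiable_def)
qed

lemma Ck_on_SucD:
  assumes "Ck_on (Suc k) S F"
  shows "Ck_on k S F"
  using assms
  by (induction k arbitrary: F)
     (auto intro!: continuous_at_imp_continuous_on differentiable_imp_continuous_within)

lemma Ck_on_derivD:
  assumes "Ck_on (Suc k) S F" "x \<in> S"
  shows "(F has_derivative frechet_derivative F (at x)) (at x)"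
  using assms by (simp add: frechet_derivative_works)

text \<open>Differentiability is local on open sets; this glues a bump function to its extension by
  zero.\<close>

lemma Ck_on_Union:
  assumes "\<And>S. S \<in> \<S> \<Longrightarrow> open S \<and> Ck_on k S F"
  shows "Ck_on k (\<Union>\<S>) F"
  using assms by (induction k arbitrary: F) (auto intro!: continuous_on_open_Union)

lemma Ck_on_const: "open S \<Longrightarrow> Ck_on k S (\<lambda>x. c)"
proof (induction k arbitrary: c)
  case (Suc k)
  then show ?case by (intro Ck_on_SucI[where F' = "\<lambda>x w. 0"]) auto
qed simp

lemma Ck_on_bounded_linear_id:
  assumes "bounded_linear T" "open S"
  shows "Ck_on k S T"
proof (cases k)
  case 0
  then show ?thesis using assms by (simp add: linear_continuous_on)
next
  case (Suc j)
  show ?thesis unfolding Suc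
    by (rule Ck_on_SucI[where F' = "\<lambda>x. T"])
       (use assms in \<open>auto intro!: Ck_on_const bounded_linear_imp_has_derivative\<close>)
qed

lemma Ck_on_bounded_linear:
  assumes "bounded_linear T" "open S" "Ck_on k S F"
  shows "Ck_on k S (\<lambda>x. T (F x))"
  using assms(3)
proof (induction k arbitrary: F)
  case 0
  then show ?case using assms(1) by (auto intro: bounded_linear.continuous_on)
next
  case (Suc k)
  show ?case
    by (rule Ck_on_SucI[where F' = "\<lambda>x w. T (frechet_derivative F (at x) w)"])
       (use assms Suc in \<open>auto intro: bounded_linear.has_derivative[OF assms(1)] simp: frechet_derivative_works\<close>)
qed

lemma Ck_on_add:
  assumes "open S" "Ck_on k S F" "Ck_on k S G"
  shows "Ck_on k S (\<lambda>x. F x + G x)"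
  using assms(2,3)
proof (induction k arbitrary: F G)
  case 0
  then show ?case by (auto intro: continuous_on_add)
next
  case (Suc k)
  show ?case
    by (rule Ck_on_SucI[OF \<open>open S\<close>, where F' = "\<lambda>x w. frechet_derivative F (at x) w + frechet_derivative G (at x) w"])
       (use Suc in \<open>auto intro!: has_derivative_add simp: frechet_derivative_works\<close>)
qed

text \<open>The Leibniz rule expresses the derivative by \<open>B\<close> applied to functions of
  class k. One induction thus serves products, scalar multiples and inner products.\<close>

lemma Ck_on_bilinear:
  assumes B: "bounded_bilinear B" and "open S" "Ck_on k S F" "Ck_on k S G"
  shows "Ck_on k S (\<lambda>x. B (F x) (G x))"
  using assms(3,4)
proof (induction k arbitrary: F G)
  case 0
  then show ?case using bounded_bilinear.continuous_on[OF B] by auto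
next
  case (Suc k)
  show ?case
    by (rule Ck_on_SucI[OF \<open>open S\<close> bounded_bilinear.FDERIV[OF B]])
       (use Suc Suc.prems[THEN Ck_on_SucD] in \<open>auto intro!: Ck_on_add \<open>open S\<close> Ck_on_derivD\<close>)
qed

lemma Ck_on_sum:
  assumes "open S" "\<And>i. i \<in> I \<Longrightarrow> Ck_on k S (F i)"
  shows "Ck_on k S (\<lambda>x. \<Sum>i\<in>I. F i x)"
  using assms by (induction I rule: infinite_finite_induct) (auto intro: Ck_on_const Ck_on_add)

text \<open>In the chain rule the direction in which \<open>F\<close> is differentiated varies with
  \<open>x\<close>, whereas \<open>Ck_on\<close> speaks of fixed directions. Expanding that
  direction in the finite basis of \<open>'e\<close> leaves only fixed directions with varying
  coefficients.\<close>

lemma Ck_on_compose: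
  fixes \<tau> :: "'a::real_normed_vector \<Rightarrow> 'e::euclidean_space" and F :: "'e \<Rightarrow> 'b::real_normed_vector"
  assumes "open S" "Ck_on k T F" "Ck_on k S \<tau>" "\<tau> ` S \<subseteq> T"
  shows "Ck_on k S (\<lambda>x. F (\<tau> x))"
  using assms(2,3)
proof (induction k arbitrary: F)
  case 0
  then show ?case using assms(4) by (auto intro: continuous_on_compose2)
next
  case (Suc k)
  let ?dF = "\<lambda>x. frechet_derivative F (at x)" and ?d\<tau> = "\<lambda>x. frechet_derivative \<tau> (at x)"
  have D: "((\<lambda>x. F (\<tau> x)) has_derivative (\<lambda>w. \<Sum>b\<in>Basis. (?d\<tau> x w \<bullet> b) *\<^sub>R ?dF (\<tau> x) b)) (at x)" if "x \<in> S" for x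
  proof -
    have F: "(F has_derivative ?dF (\<tau> x)) (at (\<tau> x))"
      using Suc.prems assms(4) that by (intro Ck_on_derivD) auto
    have D: "((\<lambda>x. F (\<tau> x)) has_derivative (\<lambda>w. ?dF (\<tau> x) (?d\<tau> x w))) (at x)"
      by (rule has_derivative_compose[OF Ck_on_derivD[OF Suc.prems(2) that] F])
    have "?dF (\<tau> x) v = (\<Sum>b\<in>Basis. (v \<bullet> b) *\<^sub>R ?dF (\<tau> x) b)" for v
    proof -
      interpret linear "?dF (\<tau> x)" using F by (rule has_derivative_linear)
      show ?thesis by (subst euclidean_representation[of v, symmetric]) (simp add: sum scale)
    qed
    then have "(\<lambda>w. ?dF (\<tau> x) (?d\<tau> x w)) = (\<lambda>w. \<Sum>b\<in>Basis. (?d\<tau> x w \<bullet> b) *\<^sub>R ?dF (\<tau> x) b)"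
      by (intro ext)
    with D show ?thesis by (rule subst[rotated])
  qed
  show ?case
    by (rule Ck_on_SucI[OF \<open>open S\<close> D])
       (use Suc Ck_on_SucD[OF Suc.prems(2)] in \<open>auto intro!: Ck_on_sum \<open>open S\<close> Ck_on_bilinear[OF bounded_bilinear_scaleR]
          Ck_on_bounded_linear[OF bounded_linear_inner_left]\<close>)
qed

section \<open>Reciprocals, determinants and solutions of linear systems\<close>

lemma Ck_on_inverse:
  fixes F :: "'a::real_normed_vector \<Rightarrow> real"
  assumes "open S" "Ck_on k S F" "\<And>x. x \<in> S \<Longrightarrow> F x \<noteq> 0"
  shows "Ck_on k S (\<lambda>x. inverse (F x))"
  using assms(2)
proof (induction k)
  case 0
  then show ?case using assms(3) by (auto intro: continuous_on_inverse)
next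
  case (Suc k)
  note mult = Ck_on_bilinear[OF bounded_bilinear_mult \<open>open S\<close>]
  show ?case
    by (rule Ck_on_SucI[OF \<open>open S\<close> Deriv.has_derivative_inverse])
       (use Suc assms(3) Ck_on_SucD[OF Suc.prems] in 
         \<open>auto intro!: mult Ck_on_bounded_linear[OF bounded_linear_minus[OF bounded_linear_ident] \<open>open S\<close>] Ck_on_derivD\<close>)
qed

lemma Ck_on_mult:
  fixes F :: "'a::real_normed_vector \<Rightarrow> real"
  shows "open S \<Longrightarrow> Ck_on k S F \<Longrightarrow> Ck_on k S G \<Longrightarrow> Ck_on k S (\<lambda>x. F x * G x)"
  by (rule Ck_on_bilinear[OF bounded_bilinear_mult])

lemma Ck_on_prod:
  fixes F :: "'i \<Rightarrow> 'a::real_normed_vector \<Rightarrow> real"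
  assumes "open S" "\<And>i. i \<in> I \<Longrightarrow> Ck_on k S (F i)"
  shows "Ck_on k S (\<lambda>x. \<Prod>i\<in>I. F i x)"
  using assms by (induction I rule: infinite_finite_induct) (auto intro: Ck_on_const Ck_on_mult)

lemma Ck_on_det:
  fixes A :: "'a::real_normed_vector \<Rightarrow> real ^ 'n ^ 'n::finite"
  assumes "open S" "\<And>i j. Ck_on k S (\<lambda>x. A x $ i $ j)"
  shows "Ck_on k S (\<lambda>x. det (A x))"
  unfolding det_def using assms by (intro Ck_on_sum Ck_on_mult Ck_on_prod Ck_on_const)

text \<open>Cramer's rule writes each component of the solution as a quotient of determinants, hence
  as a differentiable function of the data.\<close>

lemma Ck_on_cramer:
  fixes A :: "'a::real_normed_vector \<Rightarrow> real ^ 'n ^ 'n::finite"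
  assumes "open S" "\<And>i j. Ck_on k S (\<lambda>x. A x $ i $ j)" "\<And>i. Ck_on k S (\<lambda>x. b x $ i)"
    and inv: "\<And>x. x \<in> S \<Longrightarrow> det (A x) \<noteq> 0"
    and sol: "\<And>x. x \<in> S \<Longrightarrow> A x *v c x = b x"
  shows "Ck_on k S (\<lambda>x. c x $ l)"
proof (rule Ck_on_cong[OF \<open>open S\<close>])
  show "det (\<chi> i j. if j = l then b x $ i else A x $ i $ j) * inverse (det (A x)) = c x $ l" if "x \<in> S" for x
    using cramer[of "A x" "c x" "b x"] inv[OF that] sol[OF that] by (simp add: divide_inverse)
  have "Ck_on k S (\<lambda>x. if j = l then b x $ i else A x $ i $ j)" for i j
    using assms by (cases "j = l") auto
  then show "Ck_on k S (\<lambda>x. det (\<chi> i j. if j = l then b x $ i else A x $ i $ j) * inverse (det (A x)))"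
    using assms by (intro Ck_on_mult Ck_on_inverse Ck_on_det) auto
qed

section \<open>The smooth function exp(-1/t), extended by zero\<close>

definition flat_exp :: "nat \<Rightarrow> real \<Rightarrow> real" where
  "flat_exp n t = (if t > 0 then inverse t ^ n * exp (- inverse t) else 0)"

text \<open>The factors \<open>inverse t ^ n\<close> make the span of the family closed under
  differentiation. Only \<open>t = 0\<close> needs a limit argument.\<close>

lemma has_real_derivative_flat_exp:
  "(flat_exp n has_real_derivative flat_exp (n + 2) t - real n * flat_exp (n + 1) t) (at t)"
proof -
  consider "t > 0" | "t < 0" | "t = 0" by linarith
  then show ?thesis
  proof cases
    case 1
    have "((\<lambda>t. inverse t ^ n * exp (- inverse t)) has_real_derivative
            flat_exp (n + 2) t - real n * flat_exp (n + 1) t) (at t)"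
      using 1 by (cases n) (auto intro!: derivative_eq_intros simp: flat_exp_def algebra_simps power2_eq_square,
          metis One_nat_def Suc_pred neq0_conv power_Suc)
    then show ?thesis
      by (rule has_field_derivative_transform_within_open[of _ _ _ "{0<..}"]) (use 1 in \<open>auto simp: flat_exp_def\<close>)
  next
    case 2
    have "((\<lambda>t. 0) has_real_derivative 0) (at t)" by simp
    then have "(flat_exp n has_real_derivative 0) (at t)"
      by (rule has_field_derivative_transform_within_open[of _ _ _ "{..<0}"]) (use 2 in \<open>auto simp: flat_exp_def\<close>)
    then show ?thesis using 2 by (simp add: flat_exp_def)
  next
    case 3
    \<comment> \<open>With s = 1/y the difference quotient is s^(n+1) exp(-s), which tends to 0 as s
      grows.\<close>
    have "((\<lambda>y. flat_exp n y / y) \<longlongrightarrow> 0) (at_right 0)"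
    proof (rule Lim_transform_eventually)
      show "((\<lambda>y::real. inverse y ^ n * exp (- inverse y) / y) \<longlongrightarrow> 0) (at_right 0)"
        using filterlim_compose[OF tendsto_power_div_exp_0[of "Suc n"] filterlim_inverse_at_top_right]
        by (simp add: exp_minus field_simps)
      show "\<forall>\<^sub>F y in at_right (0::real). inverse y ^ n * exp (- inverse y) / y = flat_exp n y / y"
        by (auto simp: flat_exp_def eventually_at_filter)
    qed
    moreover have "((\<lambda>y. flat_exp n y / y) \<longlongrightarrow> 0) (at_left 0)"
      by (rule Lim_transform_eventually[OF tendsto_const]) (auto simp: flat_exp_def eventually_at_filter)
    ultimately have "((\<lambda>y. flat_exp n y / y) \<longlongrightarrow> 0) (at 0)"
      by (simp add: filterlim_split_at)
    then show ?thesis using 3 by (simp add: has_field_derivative_iff flat_exp_def)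
  qed
qed

text \<open>The induction has to run over all \<open>n\<close> at once, since differentiation raises
  the index.\<close>

lemma Ck_on_flat_exp: "Ck_on k UNIV (flat_exp n)"
proof (induction k arbitrary: n)
  case 0
  then show ?case
    by (auto intro!: continuous_at_imp_continuous_on DERIV_isCont has_real_derivative_flat_exp)
next
  case (Suc k)
  have C: "Ck_on k UNIV (\<lambda>x. w * flat_exp (n + 2) x + (- real n * w) * flat_exp (n + 1) x)" for w
    by (intro Ck_on_add Ck_on_mult Ck_on_const Suc open_UNIV)
  have eq: "w * flat_exp (n + 2) x + (- real n * w) * flat_exp (n + 1) x =
      (flat_exp (n + 2) x - real n * flat_exp (n + 1) x) * w" for x w
    by (simp add: algebra_simps)
  have "Ck_on k UNIV (\<lambda>x. (flat_exp (n + 2) x - real n * flat_exp (n + 1) x) * w)" for w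
    by (rule Ck_on_cong[OF open_UNIV _ C]) (rule eq)
  then show ?case
    by (intro Ck_on_SucI[OF open_UNIV has_real_derivative_flat_exp[unfolded has_field_derivative_def]])
qed

declare Ck_on.simps(2) [simp del]

section \<open>Tangent vectors and vector fields\<close>

lemma frechet_derivative_axis_sum:
  fixes F :: "real ^ 'n::finite \<Rightarrow> 'b::real_normed_vector"
  assumes "F differentiable (at x)"
  shows "frechet_derivative F (at x) w = (\<Sum>j\<in>UNIV. w $ j *\<^sub>R frechet_derivative F (at x) (axis j 1))"
proof -
  interpret linear "frechet_derivative F (at x)"
    using assms by (rule linear_frechet_derivative)
  have "frechet_derivative F (at x) (\<Sum>j\<in>UNIV. w $ j *\<^sub>R axis j 1) =
      (\<Sum>j\<in>UNIV. w $ j *\<^sub>R frechet_derivative F (at x) (axis j 1))"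
    by (simp add: sum scale)
  then show ?thesis by (simp only: basis_expansion scalar_mult_eq_scaleR[symmetric])
qed

section \<open>Charts and smooth maps\<close>

locale smooth_manifold =
  fixes M :: "('a::{t2_space,second_countable_topology}, 'n::finite) atlas"
  assumes atlas: "smooth_atlas M"
begin

lemma chart_at: obtains U \<phi> where "(U, \<phi>) \<in> M" "p \<in> U"
proof -
  have "p \<in> (\<Union>(U, \<phi>)\<in>M. U)" using atlas by (simp add: smooth_atlas_def)
  then show thesis using that by blast
qed

lemma chart_open: "(U, \<phi>) \<in> M \<Longrightarrow> open U" "(U, \<phi>) \<in> M \<Longrightarrow> open (\<phi> ` U)"
  using atlas unfolding smooth_atlas_def by blast+

lemma chart_homeomorphism: "(U, \<phi>) \<in> M \<Longrightarrow> homeomorphism U (\<phi> ` U) \<phi> (inv_into U \<phi>)"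
  using atlas unfolding smooth_atlas_def by blast

lemma chart_inv [simp]:
  assumes "(U, \<phi>) \<in> M" "p \<in> U"
  shows "inv_into U \<phi> (\<phi> p) = p"
  using chart_homeomorphism[OF assms(1)] assms(2) by (simp add: homeomorphism_def)

lemma open_chart_image:
  assumes "(U, \<phi>) \<in> M" "open V"
  shows "open (\<phi> ` (U \<inter> V))"
proof -
  have "openin (top_of_set (\<phi> ` U)) (\<phi> ` (U \<inter> V))"
    using homeomorphism_imp_open_map[OF chart_homeomorphism[OF assms(1)]] assms(2) by (simp add: openin_open_Int)
  then show ?thesis
    using chart_open(2)[OF assms(1)] openin_open_trans by blast
qed

lemma Ck_on_transition:
  "(U, \<phi>) \<in> M \<Longrightarrow> (V, \<psi>) \<in> M \<Longrightarrow> Ck_on k (\<phi> ` (U \<inter> V)) (\<lambda>x. \<psi> (inv_into U \<phi> x))"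
  using atlas by (force simp: smooth_atlas_def smooth_on_def comp_def)

lemma smooth_map_iff:
  "smooth_map M F \<longleftrightarrow> (\<forall>U \<phi> k. (U, \<phi>) \<in> M \<longrightarrow> Ck_on k (\<phi> ` U) (\<lambda>x. F (inv_into U \<phi> x)))"
  by (auto simp: smooth_map_def smooth_on_def comp_def)

lemma smooth_map_const: "smooth_map M (\<lambda>p. c)"
  by (simp add: smooth_map_iff Ck_on_const chart_open)

lemma smooth_map_add: "smooth_map M F \<Longrightarrow> smooth_map M G \<Longrightarrow> smooth_map M (\<lambda>p. F p + G p)"
  by (simp add: smooth_map_iff Ck_on_add chart_open)

lemma smooth_map_bounded_linear: "bounded_linear T \<Longrightarrow> smooth_map M F \<Longrightarrow> smooth_map M (\<lambda>p. T (F p))"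
  by (simp add: smooth_map_iff Ck_on_bounded_linear[of T] chart_open)

lemma smooth_map_bilinear:
  "bounded_bilinear B \<Longrightarrow> smooth_map M F \<Longrightarrow> smooth_map M G \<Longrightarrow> smooth_map M (\<lambda>p. B (F p) (G p))"
  by (simp add: smooth_map_iff Ck_on_bilinear[of B] chart_open)

lemma smooth_map_sum: "(\<And>i. i \<in> I \<Longrightarrow> smooth_map M (F i)) \<Longrightarrow> smooth_map M (\<lambda>p. \<Sum>i\<in>I. F i p)"
  by (simp add: smooth_map_iff Ck_on_sum chart_open)

lemmas smooth_map_minus = smooth_map_bounded_linear[OF bounded_linear_minus[OF bounded_linear_ident]]
lemmas smooth_map_mult = smooth_map_bilinear[OF bounded_bilinear_mult]
lemmas smooth_map_scaleR = smooth_map_bilinear[OF bounded_bilinear_scaleR]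
lemmas smooth_map_inner = smooth_map_bilinear[OF bounded_bilinear_inner]
lemmas smooth_map_nth = smooth_map_bounded_linear[OF bounded_linear_vec_nth]

lemma smooth_map_diff: "smooth_map M F \<Longrightarrow> smooth_map M G \<Longrightarrow> smooth_map M (\<lambda>p. F p - G p)"
  using smooth_map_add[OF _ smooth_map_minus, of F G] by simp

lemma smooth_map_vec:
  fixes F :: "'a \<Rightarrow> real ^ 'm::finite"
  assumes "\<And>i. smooth_map M (\<lambda>p. F p $ i)"
  shows "smooth_map M F"
proof -
  have "smooth_map M (\<lambda>p. \<Sum>i\<in>UNIV. F p $ i *\<^sub>R axis i (1::real))"
    using assms by (intro smooth_map_sum smooth_map_scaleR smooth_map_const)
  then show ?thesis by (simp add: basis_expansion scalar_mult_eq_scaleR[symmetric])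
qed

section \<open>Tangent vectors in coordinates\<close>

definition chart_vec :: "'a set \<Rightarrow> ('a \<Rightarrow> real ^ 'n) \<Rightarrow> 'a \<Rightarrow> real ^ 'n \<Rightarrow> 'a tvec" where
  "chart_vec U \<phi> p w =
     (\<lambda>h. if smooth_map M h then frechet_derivative (\<lambda>x. h (inv_into U \<phi> x)) (at (\<phi> p)) w else 0)"

lemma has_derivative_chart_vec:
  assumes "(U, \<phi>) \<in> M" "p \<in> U" "smooth_map M h"
  shows "((\<lambda>x. h (inv_into U \<phi> x)) has_derivative (\<lambda>w. chart_vec U \<phi> p w h)) (at (\<phi> p))"
proof -
  have "Ck_on (Suc 0) (\<phi> ` U) (\<lambda>x. h (inv_into U \<phi> x))"
    using assms unfolding smooth_map_iff by blast
  then show ?thesis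
    using Ck_on_derivD[of 0 "\<phi> ` U" _ "\<phi> p"] assms by (simp add: chart_vec_def)
qed

lemma linear_chart_vec:
  assumes "(U, \<phi>) \<in> M" "p \<in> U" "smooth_map M h"
  shows "linear (\<lambda>w. chart_vec U \<phi> p w h)"
  using has_derivative_chart_vec[OF assms] by (rule has_derivative_linear)

lemma chart_vec_add:
  assumes "(U, \<phi>) \<in> M" "p \<in> U"
  shows "chart_vec U \<phi> p (v + w) = chart_vec U \<phi> p v + chart_vec U \<phi> p w"
proof
  show "chart_vec U \<phi> p (v + w) h = (chart_vec U \<phi> p v + chart_vec U \<phi> p w) h" for h
    using linear_chart_vec[OF assms, of h] by (cases "smooth_map M h") (simp_all add: linear_add chart_vec_def)
qed

lemma chart_vec_scale:
  assumes "(U, \<phi>) \<in> M" "p \<in> U"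
  shows "chart_vec U \<phi> p (c *\<^sub>R w) = (\<lambda>h. c * chart_vec U \<phi> p w h)"
proof
  show "chart_vec U \<phi> p (c *\<^sub>R w) h = c * chart_vec U \<phi> p w h" for h
    using linear_chart_vec[OF assms, of h] by (cases "smooth_map M h") (simp_all add: linear_cmul chart_vec_def)
qed

text \<open>The chain rule for \<open>h\<close> read in the second chart, which near
  \<open>\<psi> p\<close> is \<open>h\<close> read in the first chart composed with the transition
  map.\<close>

lemma chart_vec_change:
  assumes U: "(U, \<phi>) \<in> M" "p \<in> U" and V: "(V, \<psi>) \<in> M" "p \<in> V"
  shows "chart_vec V \<psi> p w = chart_vec U \<phi> p (frechet_derivative (\<lambda>x. \<phi> (inv_into V \<psi> x)) (at (\<psi> p)) w)"
proof
  fix h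
  let ?\<tau> = "\<lambda>x. \<phi> (inv_into V \<psi> x)"
  show "chart_vec V \<psi> p w h = chart_vec U \<phi> p (frechet_derivative ?\<tau> (at (\<psi> p)) w) h"
  proof (cases "smooth_map M h")
    case True
    have "(?\<tau> has_derivative frechet_derivative ?\<tau> (at (\<psi> p))) (at (\<psi> p))"
      using Ck_on_derivD[OF Ck_on_transition[OF V(1) U(1), of "Suc 0"], of "\<psi> p"] U V by auto
    moreover have "?\<tau> (\<psi> p) = \<phi> p" using V by simp
    ultimately have "((\<lambda>x. h (inv_into U \<phi> (?\<tau> x))) has_derivative
        (\<lambda>w. chart_vec U \<phi> p (frechet_derivative ?\<tau> (at (\<psi> p)) w) h)) (at (\<psi> p))"
      using has_derivative_compose[of ?\<tau> _ "\<psi> p" UNIV] has_derivative_chart_vec[OF U True] by fastforce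
    then have "((\<lambda>x. h (inv_into V \<psi> x)) has_derivative
        (\<lambda>w. chart_vec U \<phi> p (frechet_derivative ?\<tau> (at (\<psi> p)) w) h)) (at (\<psi> p))"
      by (rule has_derivative_transform_within_open[OF _ open_chart_image[OF V(1) chart_open(1)[OF U(1)]]])
         (use U V in auto)
    from has_derivative_unique[OF this has_derivative_chart_vec[OF V True]] show ?thesis by metis
  qed (simp add: chart_vec_def)
qed

text \<open>\<open>tangent_space\<close> lets every vector choose its own chart. A change of chart
  brings all of them into a single one, from which the vector space structure is inherited. The
  value 0 on non-smooth functions is the same in \<open>chart_vec\<close> and
  \<open>tangent_space\<close>.\<close>

lemma tangent_space_chart:
  assumes "(U, \<phi>) \<in> M" "p \<in> U"
  shows "tangent_space M p = range (chart_vec U \<phi> p)"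
proof (intro set_eqI iffI)
  fix v assume "v \<in> tangent_space M p"
  then have "\<exists>(V, \<psi>)\<in>M. p \<in> V \<and> (\<exists>w. v = chart_vec V \<psi> p w)"
    unfolding tangent_space_def chart_vec_def comp_def by simp
  then obtain V \<psi> w where "(V, \<psi>) \<in> M" "p \<in> V" "v = chart_vec V \<psi> p w" by blast
  then show "v \<in> range (chart_vec U \<phi> p)"
    using chart_vec_change[OF assms] by auto
next
  fix v assume "v \<in> range (chart_vec U \<phi> p)"
  then show "v \<in> tangent_space M p"
    using assms unfolding tangent_space_def chart_vec_def comp_def by blast
qed

lemma tangent_space_add: "u \<in> tangent_space M p \<Longrightarrow> v \<in> tangent_space M p \<Longrightarrow> u + v \<in> tangent_space M p"
  by (rule chart_at[of p]) (auto simp: tangent_space_chart chart_vec_add[symmetric])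

lemma tangent_space_scale: "v \<in> tangent_space M p \<Longrightarrow> (\<lambda>h. c * v h) \<in> tangent_space M p"
  by (rule chart_at[of p]) (auto simp: tangent_space_chart chart_vec_scale[symmetric])

lemma tangent_space_0: "0 \<in> tangent_space M p"
proof -
  have "(0 :: 'a tvec) = (\<lambda>h. 0 * v h)" for v by (auto simp: fun_eq_iff)
  moreover obtain U \<phi> where "(U, \<phi>) \<in> M" "p \<in> U" by (rule chart_at)
  ultimately show ?thesis using tangent_space_scale[of "chart_vec U \<phi> p 0" p 0] by (auto simp: tangent_space_chart)
qed

lemma tangent_space_uminus: "v \<in> tangent_space M p \<Longrightarrow> - v \<in> tangent_space M p"
  using tangent_space_scale[of v p "-1"] by (simp add: fun_Compl_def)

lemma tangent_space_diff: "u \<in> tangent_space M p \<Longrightarrow> v \<in> tangent_space M p \<Longrightarrow> u - v \<in> tangent_space M p"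
  using tangent_space_add[OF _ tangent_space_uminus] by fastforce

text \<open>Any derivative of \<open>h\<close> found in a chart computes \<open>v h\<close>;
  linearity and the Leibniz rule for tangent vectors are reduced to this.\<close>

lemma tangent_derivative_unique:
  assumes "v \<in> tangent_space M p" "smooth_map M h"
    and "\<And>U \<phi> w. (U, \<phi>) \<in> M \<Longrightarrow> p \<in> U \<Longrightarrow> v = chart_vec U \<phi> p w \<Longrightarrow>
       \<exists>D. ((\<lambda>x. h (inv_into U \<phi> x)) has_derivative D) (at (\<phi> p)) \<and> D w = r"
  shows "v h = r"
proof -
  obtain U \<phi> where U: "(U, \<phi>) \<in> M" "p \<in> U" by (rule chart_at)
  then obtain w where "v = chart_vec U \<phi> p w" using assms(1) by (auto simp: tangent_space_chart)
  with U assms obtain D where "((\<lambda>x. h (inv_into U \<phi> x)) has_derivative D) (at (\<phi> p))" "D w = r" "v = chart_vec U \<phi> p w"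
    by blast
  with has_derivative_unique[OF _ has_derivative_chart_vec[OF U assms(2)]] show ?thesis by metis
qed

lemma tangent_const:
  assumes "v \<in> tangent_space M p" shows "v (\<lambda>q. c) = 0"
  by (rule tangent_derivative_unique[OF assms smooth_map_const]) (use has_derivative_const in fastforce)

lemma tangent_add:
  assumes "v \<in> tangent_space M p" "smooth_map M h" "smooth_map M k"
  shows "v (\<lambda>q. h q + k q) = v h + v k"
  by (rule tangent_derivative_unique[OF assms(1) smooth_map_add[OF assms(2,3)]])
     (auto intro!: exI conjI has_derivative_add has_derivative_chart_vec assms)

lemma tangent_mult:
  assumes "v \<in> tangent_space M p" "smooth_map M h" "smooth_map M k"
  shows "v (\<lambda>q. h q * k q) = v h * k p + h p * v k"
proof (rule tangent_derivative_unique[OF assms(1) smooth_map_mult[OF assms(2,3)]])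
  fix U \<phi> w assume U: "(U, \<phi>) \<in> M" "p \<in> U" "v = chart_vec U \<phi> p w"
  show "\<exists>D. ((\<lambda>x. h (inv_into U \<phi> x) * k (inv_into U \<phi> x)) has_derivative D) (at (\<phi> p)) \<and> D w = v h * k p + h p * v k"
    by (intro exI conjI, rule has_derivative_mult[OF has_derivative_chart_vec[OF U(1,2) assms(2)] has_derivative_chart_vec[OF U(1,2) assms(3)]])
       (simp add: U)
qed

lemma tangent_sum:
  assumes "v \<in> tangent_space M p" "\<And>i. i \<in> I \<Longrightarrow> smooth_map M (h i)"
  shows "v (\<lambda>q. \<Sum>i\<in>I. h i q) = (\<Sum>i\<in>I. v (h i))"
  using assms(2)
  by (induction I rule: infinite_finite_induct)
     (auto simp: tangent_const[OF assms(1)] tangent_add[OF assms(1)] smooth_map_sum)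

text \<open>Tangent vectors act on global functions only, so a bump function is needed to separate directions.\<close>

lemma chart_vec_nonzero:
  assumes U: "(U, \<phi>) \<in> M" "p \<in> U" and "w \<noteq> 0"
  shows "chart_vec U \<phi> p w \<noteq> 0"
proof -
  obtain r where r: "r > 0" "cball (\<phi> p) r \<subseteq> \<phi> ` U"
    using chart_open(2)[OF U(1)] U(2) open_contains_cball by (metis imageI)
  \<comment> \<open>\<open>K\<close> will contain the support of the test function. It is compact,
    hence closed in the Hausdorff space, so its complement is open.\<close>
  define K where "K = inv_into U \<phi> ` cball (\<phi> p) r"
  have "continuous_on (\<phi> ` U) (inv_into U \<phi>)"
    using chart_homeomorphism[OF U(1)] by (simp add: homeomorphism_def)
  then have "compact K"
    unfolding K_def using r(2) by (intro compact_continuous_image) (auto intro: continuous_on_subset)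
  then have "closed K" by (rule compact_imp_closed)
  \<comment> \<open>A bump supported in the ball times the linear function with gradient
    \<open>w\<close>: its derivative at the centre in direction \<open>w\<close> is a positive
    multiple of \<open>w \<bullet> w\<close>.\<close>
  define b where "b y = flat_exp 0 (r\<^sup>2 - (y - \<phi> p) \<bullet> (y - \<phi> p)) * ((y - \<phi> p) \<bullet> w)" for y
  define h where "h q = (if q \<in> U then b (\<phi> q) else 0)" for q
  have lin: "Ck_on k UNIV (\<lambda>y. y - \<phi> p)" for k
    using Ck_on_add[OF open_UNIV Ck_on_bounded_linear_id[OF bounded_linear_ident open_UNIV] Ck_on_const[OF open_UNIV, of k "- \<phi> p"]]
    by simp
  have sq: "Ck_on k UNIV (\<lambda>y. r\<^sup>2 - (y - \<phi> p) \<bullet> (y - \<phi> p))" for k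
    using Ck_on_add[OF open_UNIV Ck_on_const[OF open_UNIV] Ck_on_bounded_linear[OF bounded_linear_minus[OF bounded_linear_ident] open_UNIV
      Ck_on_bilinear[OF bounded_bilinear_inner open_UNIV lin lin]], of k "r\<^sup>2"] by simp
  have b: "Ck_on k UNIV b" for k
    unfolding b_def
    by (intro Ck_on_mult Ck_on_compose[OF _ Ck_on_flat_exp] open_UNIV sq Ck_on_bounded_linear[OF bounded_linear_inner_left] lin) auto
  have h0: "h q = 0" if "q \<notin> K" for q
  proof (cases "q \<in> U")
    case True
    then have "\<phi> q \<notin> cball (\<phi> p) r" using that U(1) by (force simp: K_def)
    then have "r < norm (\<phi> q - \<phi> p)" by (simp add: dist_norm norm_minus_commute)
    then have "r\<^sup>2 < (\<phi> q - \<phi> p) \<bullet> (\<phi> q - \<phi> p)"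
      using r(1) by (simp add: power2_norm_eq_inner[symmetric] power_strict_mono)
    then show ?thesis by (simp add: h_def b_def flat_exp_def)
  qed (simp add: h_def)
  have "smooth_map M h"
    unfolding smooth_map_iff
  proof (intro allI impI)
    fix V \<psi> k assume V: "(V, \<psi>) \<in> M"
    have "Ck_on k (\<psi> ` (V \<inter> U)) (\<lambda>x. b (\<phi> (inv_into V \<psi> x)))"
      by (rule Ck_on_compose[OF open_chart_image[OF V chart_open(1)[OF U(1)]] b Ck_on_transition[OF V U(1)]]) simp
    then have 1: "Ck_on k (\<psi> ` (V \<inter> U)) (\<lambda>x. h (inv_into V \<psi> x))"
      by (rule Ck_on_cong[OF open_chart_image[OF V chart_open(1)[OF U(1)]], rotated]) (use V in \<open>auto simp: h_def\<close>)
    have 2: "Ck_on k (\<psi> ` (V \<inter> - K)) (\<lambda>x. h (inv_into V \<psi> x))"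
      by (rule Ck_on_cong[OF open_chart_image[OF V open_Compl[OF \<open>closed K\<close>]] _ Ck_on_const[OF open_chart_image[OF V open_Compl[OF \<open>closed K\<close>]], of k 0]])
         (use V h0 in auto)
    \<comment> \<open>Since \<open>K\<close> lies in \<open>U\<close>, the open sets
      \<open>U\<close> and \<open>- K\<close> cover the manifold; \<open>h\<close> is
      \<open>b\<close> in coordinates on the first and zero on the second.\<close>
    have "K \<subseteq> U" using r(2) U(1) by (auto simp: K_def inv_into_into)
    then have "\<psi> ` V = \<Union>{\<psi> ` (V \<inter> U), \<psi> ` (V \<inter> - K)}" by auto
    moreover have "Ck_on k (\<Union>{\<psi> ` (V \<inter> U), \<psi> ` (V \<inter> - K)}) (\<lambda>x. h (inv_into V \<psi> x))"
      by (rule Ck_on_Union) (use 1 2 open_chart_image[OF V] chart_open(1)[OF U(1)] \<open>closed K\<close> in auto)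
    ultimately show "Ck_on k (\<psi> ` V) (\<lambda>x. h (inv_into V \<psi> x))" by simp
  qed
  let ?F = "\<lambda>y. flat_exp 0 (r\<^sup>2 - (y - \<phi> p) \<bullet> (y - \<phi> p))"
  obtain D where "(?F has_derivative D) (at (\<phi> p))"
    using Ck_on_derivD[OF Ck_on_compose[OF open_UNIV Ck_on_flat_exp[of "Suc 0" 0] sq subset_UNIV] UNIV_I] by blast
  \<comment> \<open>The linear factor vanishes at the centre, so the derivative \<open>D\<close> of
    the bump drops out.\<close>
  then have "(b has_derivative (\<lambda>v. ?F (\<phi> p) * (v \<bullet> w) + D v * ((\<phi> p - \<phi> p) \<bullet> w))) (at (\<phi> p))"
    unfolding b_def by (rule has_derivative_mult) (auto intro!: derivative_eq_intros)
  then have "(b has_derivative (\<lambda>v. flat_exp 0 (r\<^sup>2) * (v \<bullet> w))) (at (\<phi> p))" by simp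
  then have "((\<lambda>x. h (inv_into U \<phi> x)) has_derivative (\<lambda>v. flat_exp 0 (r\<^sup>2) * (v \<bullet> w))) (at (\<phi> p))"
    by (rule has_derivative_transform_within_open[OF _ chart_open(2)[OF U(1)]]) (use U in \<open>auto simp: h_def\<close>)
  from has_derivative_unique[OF this has_derivative_chart_vec[OF U \<open>smooth_map M h\<close>]]
  have "chart_vec U \<phi> p w h = flat_exp 0 (r\<^sup>2) * (w \<bullet> w)" by metis
  also have "\<dots> \<noteq> 0" using r \<open>w \<noteq> 0\<close> by (simp add: flat_exp_def)
  finally show ?thesis by (auto simp: fun_eq_iff)
qed

section \<open>Vector fields\<close>

lemma vector_fieldsD: "X \<in> vector_fields M \<Longrightarrow> X p \<in> tangent_space M p"
  "X \<in> vector_fields M \<Longrightarrow> smooth_map M h \<Longrightarrow> smooth_map M (\<lambda>p. X p h)"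
  by (auto simp: vector_fields_def)

lemma vector_fields_add: "X \<in> vector_fields M \<Longrightarrow> Y \<in> vector_fields M \<Longrightarrow> X + Y \<in> vector_fields M"
  by (auto simp: vector_fields_def tangent_space_add smooth_map_add)

lemma vector_fields_fmult: "smooth_map M c \<Longrightarrow> X \<in> vector_fields M \<Longrightarrow> fmult c X \<in> vector_fields M"
  by (auto simp: vector_fields_def fmult_def tangent_space_scale smooth_map_mult)

lemma vector_fields_0: "0 \<in> vector_fields M"
  by (auto simp: vector_fields_def tangent_space_0 smooth_map_const)

lemma vector_fields_uminus: "X \<in> vector_fields M \<Longrightarrow> - X \<in> vector_fields M"
  by (auto simp: vector_fields_def tangent_space_uminus smooth_map_minus)

lemma vector_fields_diff: "X \<in> vector_fields M \<Longrightarrow> Y \<in> vector_fields M \<Longrightarrow> X - Y \<in> vector_fields M"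
  by (auto simp: vector_fields_def tangent_space_diff smooth_map_diff)

lemma vector_fields_sum: "(\<And>i. i \<in> I \<Longrightarrow> X i \<in> vector_fields M) \<Longrightarrow> (\<Sum>i\<in>I. X i) \<in> vector_fields M"
  by (induction I rule: infinite_finite_induct) (auto intro: vector_fields_add vector_fields_0)

end

section \<open>Immersed manifolds\<close>

lemma sum_fun_apply: "(\<Sum>i\<in>I. F i) p = (\<Sum>i\<in>I. F i p)"
  by (induction I rule: infinite_finite_induct) simp_all

lemma vderiv_add_tvec: "vderiv (u + v) V = vderiv u V + vderiv v V"
  by (simp add: vderiv_def vec_eq_iff)

lemma vderiv_diff_tvec: "vderiv (u - v) V = vderiv u V - vderiv v V"
  by (simp add: vderiv_def vec_eq_iff)

lemma vderiv_uminus_tvec: "vderiv (- v) V = - vderiv v V"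
  by (simp add: vderiv_def vec_eq_iff)

lemma vderiv_scale_tvec: "vderiv (\<lambda>h. c * v h) V = c *\<^sub>R vderiv v V"
  by (simp add: vderiv_def vec_eq_iff)

lemma vderiv_sum_tvec: "vderiv (\<Sum>i\<in>I. v i) V = (\<Sum>i\<in>I. vderiv (v i) V)"
  by (simp add: vderiv_def vec_eq_iff sum_fun_apply)

lemmas vderiv_tvec = vderiv_uminus_tvec vderiv_add_tvec vderiv_diff_tvec vderiv_scale_tvec vderiv_sum_tvec

context smooth_manifold
begin

lemma vderiv_add:
  "v \<in> tangent_space M p \<Longrightarrow> smooth_map M V \<Longrightarrow> smooth_map M W \<Longrightarrow>
     vderiv v (\<lambda>q. V q + W q) = vderiv v V + vderiv v W"
  by (simp add: vderiv_def vec_eq_iff tangent_add[of v p] smooth_map_nth)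

lemma vderiv_scaleR:
  "v \<in> tangent_space M p \<Longrightarrow> smooth_map M c \<Longrightarrow> smooth_map M V \<Longrightarrow>
     vderiv v (\<lambda>q. c q *\<^sub>R V q) = v c *\<^sub>R V p + c p *\<^sub>R vderiv v V"
  by (simp add: vderiv_def vec_eq_iff tangent_mult[of v p] smooth_map_nth)

lemma tangent_inner:
  fixes V W :: "'a \<Rightarrow> real ^ 'm::finite"
  assumes "v \<in> tangent_space M p" "smooth_map M V" "smooth_map M W"
  shows "v (\<lambda>q. V q \<bullet> W q) = vderiv v V \<bullet> W p + V p \<bullet> vderiv v W"
  using assms
  by (simp add: vderiv_def inner_vec_def tangent_sum[of v p] tangent_mult[of v p] smooth_map_nth smooth_map_mult sum.distrib)

lemma smooth_map_flat_conn: "X \<in> vector_fields M \<Longrightarrow> smooth_map M V \<Longrightarrow> smooth_map M (flat_conn X V)"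
  by (rule smooth_map_vec) (simp add: flat_conn_def vderiv_def vector_fieldsD smooth_map_nth)

end

locale immersed_manifold = smooth_manifold M
  for M :: "('a::{t2_space,second_countable_topology}, 'n::finite) atlas" +
  fixes g :: "'a metric" and f :: "'a \<Rightarrow> real ^ 'm::finite"
  assumes metric: "riemannian_metric M g" and immersion: "isometric_immersion M g f"
begin

lemma smooth_f: "smooth_map M f"
  using immersion by (simp add: isometric_immersion_def)

lemma g_eq_inner: "u \<in> tangent_space M p \<Longrightarrow> v \<in> tangent_space M p \<Longrightarrow> g p u v = vderiv u f \<bullet> vderiv v f"
  using immersion by (simp add: isometric_immersion_def)

lemma vderiv_f_eq_0:
  assumes "u \<in> tangent_space M p" "vderiv u f = 0"
  shows "u = 0"
proof (rule ccontr)
  assume "u \<noteq> 0"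
  then have "g p u u > 0" using metric assms(1) by (simp add: riemannian_metric_def)
  then show False using g_eq_inner assms by simp
qed

lemma vderiv_f_inject:
  assumes "u \<in> tangent_space M p" "v \<in> tangent_space M p" "vderiv u f = vderiv v f"
  shows "u = v"
  using vderiv_f_eq_0[OF tangent_space_diff[OF assms(1,2)]] assms(3) by (simp add: vderiv_tvec)

text \<open>The difference of the two vectors is itself an admissible test vector, so its image has
  length zero.\<close>

lemma tangent_eqI:
  assumes "u \<in> tangent_space M p" "v \<in> tangent_space M p"
    and "\<And>w. w \<in> tangent_space M p \<Longrightarrow> vderiv u f \<bullet> vderiv w f = vderiv v f \<bullet> vderiv w f"
  shows "u = v"
proof (rule vderiv_f_inject[OF assms(1,2)])
  have "(vderiv u f - vderiv v f) \<bullet> (vderiv u f - vderiv v f) = 0"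
    using assms(3)[OF tangent_space_diff[OF assms(1,2)]] by (simp add: vderiv_tvec inner_diff_left)
  then show "vderiv u f = vderiv v f" by simp
qed

section \<open>The metric in coordinates and the existence of gradients\<close>

definition chart_frame :: "'a set \<Rightarrow> ('a \<Rightarrow> real ^ 'n) \<Rightarrow> 'a \<Rightarrow> 'n \<Rightarrow> 'a tvec" where
  "chart_frame U \<phi> p j = chart_vec U \<phi> p (axis j 1)"

definition gram :: "'a set \<Rightarrow> ('a \<Rightarrow> real ^ 'n) \<Rightarrow> 'a \<Rightarrow> real ^ 'n ^ 'n" where
  "gram U \<phi> p = (\<chi> j k. vderiv (chart_frame U \<phi> p j) f \<bullet> vderiv (chart_frame U \<phi> p k) f)"

lemma chart_vec_frame:
  assumes "(U, \<phi>) \<in> M" "p \<in> U" "smooth_map M h"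
  shows "chart_vec U \<phi> p w h = (\<Sum>j\<in>UNIV. w $ j * chart_frame U \<phi> p j h)"
  using frechet_derivative_axis_sum[of "\<lambda>x. h (inv_into U \<phi> x)" "\<phi> p" w] has_derivative_chart_vec[OF assms] assms(3)
  by (auto simp: chart_vec_def chart_frame_def differentiable_def)

lemma vderiv_chart_vec:
  fixes V :: "'a \<Rightarrow> real ^ 'k"
  assumes "(U, \<phi>) \<in> M" "p \<in> U" "smooth_map M V"
  shows "vderiv (chart_vec U \<phi> p w) V = (\<Sum>j\<in>UNIV. w $ j *\<^sub>R vderiv (chart_frame U \<phi> p j) V)"
  using assms by (simp add: vderiv_def vec_eq_iff chart_vec_frame smooth_map_nth)

lemma inner_gram:
  assumes "(U, \<phi>) \<in> M" "p \<in> U"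
  shows "vderiv (chart_vec U \<phi> p v) f \<bullet> vderiv (chart_vec U \<phi> p w) f = v \<bullet> (gram U \<phi> p *v w)"
  using assms
  by (simp add: vderiv_chart_vec smooth_f gram_def matrix_vector_mult_def inner_vec_def[of v]
      inner_sum_left inner_sum_right sum_distrib_left mult_ac) (rule sum.swap)

text \<open>A kernel vector gives a tangent vector of length zero, hence the zero operator;
  \<open>chart_vec_nonzero\<close> then makes its coordinates vanish.\<close>

lemma invertible_gram:
  assumes "(U, \<phi>) \<in> M" "p \<in> U"
  shows "invertible (gram U \<phi> p)"
proof -
  have "w = 0" if "gram U \<phi> p *v w = 0" for w
  proof -
    have "vderiv (chart_vec U \<phi> p w) f \<bullet> vderiv (chart_vec U \<phi> p w) f = 0"
      using inner_gram[OF assms, of w w] that by simp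
    then have "chart_vec U \<phi> p w = 0"
      using tangent_space_chart[OF assms] by (intro vderiv_f_eq_0[of _ p]) auto
    then show ?thesis using chart_vec_nonzero[OF assms] by auto
  qed
  then show ?thesis
    using matrix_left_invertible_ker[of "gram U \<phi> p"] by (metis invertible_left_inverse)
qed

text \<open>The coordinates of the gradient: the inverse metric matrix applied to the partial
  derivatives of \<open>h\<close>, given as a solution so that Cramer's rule fits.\<close>

definition grad_coeff :: "'a set \<Rightarrow> ('a \<Rightarrow> real ^ 'n) \<Rightarrow> ('a \<Rightarrow> real) \<Rightarrow> 'a \<Rightarrow> real ^ 'n" where
  "grad_coeff U \<phi> h p = (SOME c. gram U \<phi> p *v c = (\<chi> j. chart_frame U \<phi> p j h))"

lemma gram_grad_coeff:
  assumes "(U, \<phi>) \<in> M" "p \<in> U"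
  shows "gram U \<phi> p *v grad_coeff U \<phi> h p = (\<chi> j. chart_frame U \<phi> p j h)"
proof -
  obtain B where "gram U \<phi> p ** B = mat 1"
    using invertible_gram[OF assms] by (auto simp: invertible_def)
  then have "gram U \<phi> p *v (B *v b) = b" for b by (simp add: matrix_vector_mul_assoc)
  then show ?thesis unfolding grad_coeff_def by (rule someI)
qed

lemma inner_grad_coeff:
  assumes U: "(U, \<phi>) \<in> M" "p \<in> U" and "smooth_map M h" and "u \<in> tangent_space M p"
  shows "vderiv (chart_vec U \<phi> p (grad_coeff U \<phi> h p)) f \<bullet> vderiv u f = u h"
proof -
  obtain w where u: "u = chart_vec U \<phi> p w" using assms(4) tangent_space_chart[OF U] by auto
  have "vderiv u f \<bullet> vderiv (chart_vec U \<phi> p (grad_coeff U \<phi> h p)) f = u h"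
    unfolding u inner_gram[OF U] gram_grad_coeff[OF U] by (simp add: inner_vec_def chart_vec_frame[OF U assms(3)])
  then show ?thesis by (simp add: inner_commute)
qed

lemma Ck_on_chart_frame:
  assumes U: "(U, \<phi>) \<in> M" and h: "smooth_map M h"
  shows "Ck_on k (\<phi> ` U) (\<lambda>x. chart_frame U \<phi> (inv_into U \<phi> x) j h)"
proof -
  have "Ck_on (Suc k) (\<phi> ` U) (\<lambda>x. h (inv_into U \<phi> x))" using assms by (simp add: smooth_map_iff)
  then have "Ck_on k (\<phi> ` U) (\<lambda>x. frechet_derivative (\<lambda>x. h (inv_into U \<phi> x)) (at x) (axis j 1))"
    by (simp add: Ck_on.simps(2))
  then show ?thesis
    by (rule Ck_on_cong[OF chart_open(2)[OF U], rotated]) (use U h in \<open>auto simp: chart_frame_def chart_vec_def\<close>)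
qed

lemma Ck_on_grad_coeff:
  assumes U: "(U, \<phi>) \<in> M" and h: "smooth_map M h"
  shows "Ck_on k (\<phi> ` U) (\<lambda>x. grad_coeff U \<phi> h (inv_into U \<phi> x) $ l)"
proof (rule Ck_on_cramer[OF chart_open(2)[OF U]])
  show "Ck_on k (\<phi> ` U) (\<lambda>x. gram U \<phi> (inv_into U \<phi> x) $ i $ j)" for i j
    using assms smooth_f
    by (auto simp: gram_def inner_vec_def vderiv_def chart_open intro!: Ck_on_sum Ck_on_mult Ck_on_chart_frame smooth_map_nth)
  show "Ck_on k (\<phi> ` U) (\<lambda>x. (\<chi> j. chart_frame U \<phi> (inv_into U \<phi> x) j h) $ i)" for i
    using Ck_on_chart_frame[OF assms] by simp
  show "det (gram U \<phi> (inv_into U \<phi> x)) \<noteq> 0" if "x \<in> \<phi> ` U" for x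
    using that invertible_gram U by (auto simp: invertible_det_nz)
  show "gram U \<phi> (inv_into U \<phi> x) *v grad_coeff U \<phi> h (inv_into U \<phi> x) =
      (\<chi> j. chart_frame U \<phi> (inv_into U \<phi> x) j h)" if "x \<in> \<phi> ` U" for x
    using that gram_grad_coeff U by auto
qed

text \<open>The gradient exists at each point by the coordinate formula, and its defining property
  determines it there. The pointwise choice therefore agrees with the formula in every chart, which
  yields smoothness.\<close>

lemma gradient_exists:
  assumes h: "smooth_map M h"
  shows "\<exists>W\<in>vector_fields M. \<forall>p. \<forall>u\<in>tangent_space M p. vderiv (W p) f \<bullet> vderiv u f = u h"
proof -
  have "\<exists>v\<in>tangent_space M p. \<forall>u\<in>tangent_space M p. vderiv v f \<bullet> vderiv u f = u h" for p
  proof -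
    obtain U \<phi> where "(U, \<phi>) \<in> M" "p \<in> U" by (rule chart_at)
    then show ?thesis
      using inner_grad_coeff[OF _ _ h]
      by (intro bexI[of _ "chart_vec U \<phi> p (grad_coeff U \<phi> h p)"]) (auto simp: tangent_space_chart)
  qed
  then obtain W where W: "\<And>p. W p \<in> tangent_space M p"
      "\<And>p u. u \<in> tangent_space M p \<Longrightarrow> vderiv (W p) f \<bullet> vderiv u f = u h"
    by metis
  have chart: "W p = chart_vec U \<phi> p (grad_coeff U \<phi> h p)" if "(U, \<phi>) \<in> M" "p \<in> U" for U \<phi> p
    by (rule tangent_eqI[OF W(1)])
       (use that W inner_grad_coeff[OF that h] in \<open>auto simp: tangent_space_chart\<close>)
  have "smooth_map M (\<lambda>p. W p k)" if "smooth_map M k" for k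
    unfolding smooth_map_iff
  proof (intro allI impI)
    fix U \<phi> n assume U: "(U, \<phi>) \<in> M"
    have "Ck_on n (\<phi> ` U) (\<lambda>x. \<Sum>j\<in>UNIV. grad_coeff U \<phi> h (inv_into U \<phi> x) $ j * chart_frame U \<phi> (inv_into U \<phi> x) j k)"
      using U h that by (intro Ck_on_sum Ck_on_mult Ck_on_grad_coeff Ck_on_chart_frame chart_open)
    then show "Ck_on n (\<phi> ` U) (\<lambda>x. W (inv_into U \<phi> x) k)"
      by (rule Ck_on_cong[OF chart_open(2)[OF U], rotated])
         (use U in \<open>auto simp: chart chart_vec_frame that\<close>)
  qed
  then show ?thesis using W by (intro bexI[of _ W]) (auto simp: vector_fields_def)
qed

text \<open>With \<open>F = f\<close> this yields tangential parts; with \<open>V\<close> normal and \<open>F = \<T>\<close> it yields \<open>\<Y>\<close>, because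
  \<open>\<langle>\<eta>, L X\<rangle> = \<langle>\<eta>, D\<^sub>X \<T>\<rangle>\<close>.\<close>

lemma vector_field_representing:
  fixes V F :: "'a \<Rightarrow> real ^ 'k::finite"
  assumes V: "smooth_map M V" and F: "smooth_map M F"
  shows "\<exists>W\<in>vector_fields M. \<forall>p. \<forall>u\<in>tangent_space M p. vderiv (W p) f \<bullet> vderiv u f = V p \<bullet> vderiv u F"
proof -
  obtain W where W: "\<And>i. W i \<in> vector_fields M"
      "\<And>i p u. u \<in> tangent_space M p \<Longrightarrow> vderiv (W i p) f \<bullet> vderiv u f = u (\<lambda>q. F q $ i)"
    using gradient_exists[OF smooth_map_nth[OF F]] by metis
  show ?thesis
  proof (intro bexI ballI allI)
    \<comment> \<open>The witness is the sum of the gradients of the components of \<open>F\<close>,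
      weighted by the components of \<open>V\<close>.\<close>
    show "(\<Sum>i\<in>UNIV. fmult (\<lambda>p. V p $ i) (W i)) \<in> vector_fields M"
      using W V by (intro vector_fields_sum vector_fields_fmult smooth_map_nth)
    have ev: "(\<Sum>i\<in>UNIV. fmult (\<lambda>p. V p $ i) (W i)) p = (\<Sum>i\<in>UNIV. fmult (\<lambda>p. V p $ i) (W i) p)" for p
      by (rule sum_fun_apply)
    show "vderiv ((\<Sum>i\<in>UNIV. fmult (\<lambda>p. V p $ i) (W i)) p) f \<bullet> vderiv u f = V p \<bullet> vderiv u F"
      if "u \<in> tangent_space M p" for p u
      unfolding ev by (simp add: fmult_def vderiv_tvec inner_sum_left W(2)[OF that] vderiv_def[of u F] inner_vec_def[of "V p"])
  qed
qed

text \<open>The tangential projection of the constant ambient vector \<open>vderiv v f\<close> is a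
  global field, and at \<open>p\<close> it returns \<open>v\<close>.\<close>

lemma vector_field_through:
  assumes "v \<in> tangent_space M p"
  shows "\<exists>X\<in>vector_fields M. X p = v"
proof -
  obtain X where "X \<in> vector_fields M" "\<forall>q. \<forall>u\<in>tangent_space M q. vderiv (X q) f \<bullet> vderiv u f = vderiv v f \<bullet> vderiv u f"
    using vector_field_representing[OF smooth_map_const smooth_f] by blast
  moreover from this have "X p = v" using assms by (intro tangent_eqI[of _ p]) (auto simp: vector_fieldsD)
  ultimately show ?thesis by blast
qed

section \<open>Vector fields as ambient-valued functions\<close>

lemma push_add: "push f (X + Y) = push f X + push f Y"
  by (auto simp: push_def vderiv_tvec)

lemma push_diff: "push f (X - Y) = push f X - push f Y"
  by (auto simp: push_def vderiv_tvec)

lemma push_uminus: "push f (- X) = - push f X"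
  by (auto simp: push_def vderiv_tvec)

lemma push_fmult: "push f (fmult c X) = sec_mult c (push f X)"
  by (auto simp: push_def fmult_def sec_mult_def vderiv_tvec)

lemma smooth_map_push: "X \<in> vector_fields M \<Longrightarrow> smooth_map M (push f X)"
  using smooth_map_flat_conn[OF _ smooth_f, of X] by (simp add: push_def flat_conn_def)

lemma push_inject:
  assumes "X \<in> vector_fields M" "Y \<in> vector_fields M" "push f X = push f Y"
  shows "X = Y"
proof
  show "X p = Y p" for p
    using assms(1,2) fun_cong[OF assms(3), of p] by (intro vderiv_f_inject[of _ p]) (simp_all add: vector_fieldsD push_def)
qed

lemma ip_eq: "X \<in> vector_fields M \<Longrightarrow> Y \<in> vector_fields M \<Longrightarrow> ip g X Y p = push f X p \<bullet> push f Y p"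
  by (simp add: ip_def g_eq_inner vector_fieldsD push_def)

lemma vector_field_eqI:
  assumes "X \<in> vector_fields M" "Y \<in> vector_fields M"
    and "\<And>Z p. Z \<in> vector_fields M \<Longrightarrow> push f X p \<bullet> push f Z p = push f Y p \<bullet> push f Z p"
  shows "X = Y"
proof
  show "X p = Y p" for p
  proof (rule tangent_eqI)
    fix w assume "w \<in> tangent_space M p"
    then obtain Z where "Z \<in> vector_fields M" "Z p = w" using vector_field_through by blast
    then show "vderiv (X p) f \<bullet> vderiv w f = vderiv (Y p) f \<bullet> vderiv w f"
      using assms(3)[of Z p] by (auto simp: push_def)
  qed (use assms in \<open>auto simp: vector_fieldsD\<close>)
qed

text \<open>Evaluates the definite descriptions in \<open>gradient\<close>, \<open>shape_op\<close>
  and \<open>bend_Y\<close>: each prescribes inner products with all vector fields, and these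
  determine a field.\<close>

lemma the_vector_field:
  assumes "W \<in> vector_fields M" "P W"
    and "\<And>W'. W' \<in> vector_fields M \<Longrightarrow> P W' \<Longrightarrow> \<forall>Y\<in>vector_fields M. \<forall>p. ip g W' Y p = ip g W Y p"
  shows "(THE W. W \<in> vector_fields M \<and> P W) = W"
proof (rule the_equality)
  fix W' assume "W' \<in> vector_fields M \<and> P W'"
  then show "W' = W"
    using assms(1) assms(3)[of W'] by (intro vector_field_eqI) (auto simp: ip_eq)
qed (use assms in auto)

section \<open>Normal sections and the orthogonal splitting\<close>

lemma normal_sectionsI:
  assumes "smooth_map M \<eta>" "\<And>X p. X \<in> vector_fields M \<Longrightarrow> \<eta> p \<bullet> push f X p = 0"
  shows "\<eta> \<in> normal_sections M f"
  using assms vector_field_through by (force simp: normal_sections_def normal_space_def push_def)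

lemma normal_sectionsD:
  assumes "\<eta> \<in> normal_sections M f"
  shows "smooth_map M \<eta>" "X \<in> vector_fields M \<Longrightarrow> \<eta> p \<bullet> push f X p = 0" 
    "X \<in> vector_fields M \<Longrightarrow> push f X p \<bullet> \<eta> p = 0"
  using assms by (auto simp: normal_sections_def normal_space_def push_def vector_fieldsD inner_commute)

lemma normal_sections_add: "\<xi> \<in> normal_sections M f \<Longrightarrow> \<eta> \<in> normal_sections M f \<Longrightarrow> \<xi> + \<eta> \<in> normal_sections M f"
  using smooth_map_add[of \<xi> \<eta>] by (auto intro!: normal_sectionsI simp: normal_sectionsD inner_add_left plus_fun_def)

lemma normal_sections_diff: "\<xi> \<in> normal_sections M f \<Longrightarrow> \<eta> \<in> normal_sections M f \<Longrightarrow> \<xi> - \<eta> \<in> normal_sections M f"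
  using smooth_map_diff[of \<xi> \<eta>] by (auto intro!: normal_sectionsI simp: normal_sectionsD inner_diff_left fun_diff_def)

lemma normal_sections_sec_mult: "smooth_map M c \<Longrightarrow> \<eta> \<in> normal_sections M f \<Longrightarrow> sec_mult c \<eta> \<in> normal_sections M f"
  using smooth_map_scaleR[of c \<eta>] by (auto intro!: normal_sectionsI simp: normal_sectionsD sec_mult_def)

text \<open>The field representing \<open>V\<close> against \<open>f\<close> has the same inner
  products with tangent vectors as \<open>V\<close>, so the remainder is normal.\<close>

lemma decompose:
  assumes "smooth_map M V"
  obtains W \<eta> where "W \<in> vector_fields M" "\<eta> \<in> normal_sections M f" "V = push f W + \<eta>"
proof -
  obtain W where W: "W \<in> vector_fields M" "\<forall>p. \<forall>u\<in>tangent_space M p. vderiv (W p) f \<bullet> vderiv u f = V p \<bullet> vderiv u f"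
    using vector_field_representing[OF assms smooth_f] by blast
  then have "V - push f W \<in> normal_sections M f"
    using smooth_map_diff[OF assms smooth_map_push[OF W(1)]]
    by (intro normal_sectionsI) (auto simp: fun_diff_def inner_diff_left, simp add: push_def vector_fieldsD)
  then show ?thesis using that[OF W(1), of "V - push f W"] by simp
qed

text \<open>Two candidates for the normal part differ by a vector that is both tangent and normal,
  hence orthogonal to itself.\<close>

lemma normal_part_eq:
  assumes W: "W \<in> vector_fields M" and \<eta>: "\<eta> \<in> normal_sections M f"
  shows "normal_part M f (push f W + \<eta>) = \<eta>"
proof
  fix p
  show "normal_part M f (push f W + \<eta>) p = \<eta> p"
    unfolding normal_part_def
  proof (rule the_equality)
    show "\<eta> p \<in> normal_space M f p \<and> (push f W + \<eta>) p - \<eta> p \<in> (\<lambda>v. vderiv v f) ` tangent_space M p"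
      using assms by (auto simp: normal_sections_def push_def vector_fieldsD)
    fix \<xi> assume \<xi>: "\<xi> \<in> normal_space M f p \<and> (push f W + \<eta>) p - \<xi> \<in> (\<lambda>v. vderiv v f) ` tangent_space M p"
    then obtain v where v: "v \<in> tangent_space M p" "vderiv (W p) f + \<eta> p - \<xi> = vderiv v f"
      by (auto simp: push_def)
    have d: "\<eta> p - \<xi> = vderiv (v - W p) f" using v(2) by (simp add: vderiv_tvec algebra_simps)
    have "(\<eta> p - \<xi>) \<bullet> vderiv (v - W p) f = 0"
      using \<xi> \<eta> tangent_space_diff[OF v(1) vector_fieldsD(1)[OF W]]
      by (auto simp: normal_sections_def normal_space_def inner_diff_left)
    then show "\<xi> = \<eta> p" by (simp add: d[symmetric])
  qed
qed

lemma normal_part_decompose: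
  assumes "smooth_map M V"
  obtains W where "W \<in> vector_fields M" "normal_part M f V \<in> normal_sections M f" "V = push f W + normal_part M f V"
  using decompose[OF assms] normal_part_eq by metis

lemma decomposition_unique:
  assumes "push f W + \<eta> = push f W' + \<eta>'" "W \<in> vector_fields M" "W' \<in> vector_fields M"
    "\<eta> \<in> normal_sections M f" "\<eta>' \<in> normal_sections M f"
  shows "W = W'" "\<eta> = \<eta>'"
proof -
  show "\<eta> = \<eta>'" using normal_part_eq assms by metis
  then show "W = W'" using assms by (intro push_inject) auto
qed

end

section \<open>Conformal infinitesimal bendings\<close>

lemma flat_conn_add_field: "flat_conn (X + Y) V = flat_conn X V + flat_conn Y V"
  by (auto simp: flat_conn_def vderiv_tvec)

lemma flat_conn_diff_field: "flat_conn (X - Y) V = flat_conn X V - flat_conn Y V"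
  by (auto simp: flat_conn_def vderiv_tvec)

lemma flat_conn_push: "flat_conn X f = push f X"
  by (simp add: flat_conn_def push_def)

text \<open>Flatness of the connection. As vector fields are operators on functions, it is the
  definition of the bracket read componentwise.\<close>

lemma flat_conn_lie_bracket: "flat_conn (lie_bracket X Y) V = flat_conn X (flat_conn Y V) - flat_conn Y (flat_conn X V)"
  by (auto simp: flat_conn_def vderiv_def lie_bracket_def vec_eq_iff)

context smooth_manifold
begin

lemma smooth_map_plus [simp]: "smooth_map M F \<Longrightarrow> smooth_map M G \<Longrightarrow> smooth_map M (F + G)"
  using smooth_map_add[of F G] by (simp add: plus_fun_def)

lemma smooth_map_subtract [simp]: "smooth_map M F \<Longrightarrow> smooth_map M G \<Longrightarrow> smooth_map M (F - G)"
  using smooth_map_diff[of F G] by (simp add: fun_diff_def)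

lemma smooth_map_sec_mult [simp]: "smooth_map M c \<Longrightarrow> smooth_map M V \<Longrightarrow> smooth_map M (sec_mult c V)"
  by (simp add: sec_mult_def smooth_map_scaleR)

declare smooth_map_flat_conn [simp] vector_fieldsD [simp]
  vector_fields_add [simp] vector_fields_diff [simp] vector_fields_fmult [simp]

lemma flat_conn_add:
  "X \<in> vector_fields M \<Longrightarrow> smooth_map M V \<Longrightarrow> smooth_map M W \<Longrightarrow>
     flat_conn X (V + W) = flat_conn X V + flat_conn X W"
  using vderiv_add[of "X p" p V W for p] by (auto simp: flat_conn_def plus_fun_def)

lemma flat_conn_sec_mult:
  "X \<in> vector_fields M \<Longrightarrow> smooth_map M c \<Longrightarrow> smooth_map M V \<Longrightarrow>
     flat_conn X (sec_mult c V) = sec_mult (\<lambda>p. X p c) V + sec_mult c (flat_conn X V)"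
  using vderiv_scaleR[of "X p" p c V for p] by (auto simp: flat_conn_def sec_mult_def)

lemma flat_conn_diff:
  assumes "X \<in> vector_fields M" "smooth_map M V" "smooth_map M W"
  shows "flat_conn X (V - W) = flat_conn X V - flat_conn X W"
  using flat_conn_add[OF assms(1) smooth_map_subtract[OF assms(2,3)] assms(3)] by simp

lemma flat_conn_inner:
  assumes "X \<in> vector_fields M" "smooth_map M V" "smooth_map M W"
  shows "X p (\<lambda>q. V q \<bullet> W q) = flat_conn X V p \<bullet> W p + V p \<bullet> flat_conn X W p"
  using tangent_inner[OF vector_fieldsD(1)[OF assms(1)] assms(2,3)] by (simp add: flat_conn_def)

text \<open>Serves to differentiate the skewness of \<open>bend_L\<close> and the relation that
  defines \<open>bend_Y\<close>.\<close>

lemma flat_conn_inner_const: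
  assumes "X \<in> vector_fields M" "smooth_map M V" "smooth_map M W" "smooth_map M V'" "smooth_map M W'"
    and "\<And>q. V q \<bullet> W q + V' q \<bullet> W' q = c"
  shows "flat_conn X V p \<bullet> W p + V p \<bullet> flat_conn X W p + flat_conn X V' p \<bullet> W' p + V' p \<bullet> flat_conn X W' p = 0"
proof -
  have "X p (\<lambda>q. V q \<bullet> W q + V' q \<bullet> W' q) = X p (\<lambda>q. V q \<bullet> W q) + X p (\<lambda>q. V' q \<bullet> W' q)"
    using assms by (intro tangent_add[of _ p] smooth_map_inner) auto
  then show ?thesis
    using assms tangent_const[of "X p" p c] by (simp add: flat_conn_inner)
qed

end

text \<open>Alternating the two symmetries gives c x y z = c y x z = - c y z x = - c z y x = c z x y
  = c x z y = - c x y z.\<close>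

lemma skew_symmetric_zero:
  fixes c :: "'b \<Rightarrow> 'b \<Rightarrow> 'b \<Rightarrow> real"
  assumes "\<And>x y z. x \<in> S \<Longrightarrow> y \<in> S \<Longrightarrow> z \<in> S \<Longrightarrow> c x y z = c y x z"
    and "\<And>x y z. x \<in> S \<Longrightarrow> y \<in> S \<Longrightarrow> z \<in> S \<Longrightarrow> c x y z = - c x z y"
    and "x \<in> S" "y \<in> S" "z \<in> S"
  shows "c x y z = 0"
  using assms(1)[of x y z] assms(1)[of x z y] assms(1)[of y z x]
    assms(2)[of x y z] assms(2)[of y z x] assms(2)[of z x y] assms(3-5) by auto

section \<open>Gauss and Weingarten formulas\<close>

locale levi_civita_immersion = immersed_manifold M g f
  for M :: "('a::{t2_space,second_countable_topology}, 'n::finite) atlas"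
    and g :: "'a metric" and f :: "'a \<Rightarrow> real ^ 'm::finite" +
  fixes nab :: "'a connection"
  assumes nab: "levi_civita M g nab"
begin

abbreviation "vf \<equiv> vector_fields M"
abbreviation "ns \<equiv> normal_sections M f"
abbreviation "D \<equiv> flat_conn :: 'a vfield \<Rightarrow> ('a \<Rightarrow> real ^ 'm) \<Rightarrow> 'a \<Rightarrow> real ^ 'm"
abbreviation "P \<equiv> push f"
abbreviation "\<alpha> \<equiv> second_ff M f"
abbreviation "nconn \<equiv> normal_conn M f"
abbreviation "A \<equiv> shape_op M g \<alpha>"

declare smooth_f [simp] smooth_map_push [simp] normal_sections_add [simp] normal_sections_diff [simp]
  normal_sections_sec_mult [simp]

lemma normal_smooth [simp]: "\<eta> \<in> ns \<Longrightarrow> smooth_map M \<eta>"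
  by (rule normal_sectionsD)

lemma normal_inner_push [simp]: "\<eta> \<in> ns \<Longrightarrow> X \<in> vf \<Longrightarrow> \<eta> p \<bullet> P X p = 0"
  "\<eta> \<in> ns \<Longrightarrow> X \<in> vf \<Longrightarrow> P X p \<bullet> \<eta> p = 0"
  by (rule normal_sectionsD; assumption)+

lemma nab_vf [simp]: "X \<in> vf \<Longrightarrow> Y \<in> vf \<Longrightarrow> nab X Y \<in> vf"
  using nab by (simp add: levi_civita_def affine_connection_def)

lemma nab_torsion_free: "X \<in> vf \<Longrightarrow> Y \<in> vf \<Longrightarrow> lie_bracket X Y = nab X Y - nab Y X"
  using nab by (simp add: levi_civita_def)

lemma nab_metric:
  "X \<in> vf \<Longrightarrow> Y \<in> vf \<Longrightarrow> Z \<in> vf \<Longrightarrow> X p (ip g Y Z) = ip g (nab X Y) Z p + ip g Y (nab X Z) p"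
  using nab by (simp add: levi_civita_def)

lemma ip_fun_eq: "X \<in> vf \<Longrightarrow> Y \<in> vf \<Longrightarrow> ip g X Y = (\<lambda>p. P X p \<bullet> P Y p)"
  by (auto simp: ip_eq)

lemma smooth_ip [simp]: "X \<in> vf \<Longrightarrow> Y \<in> vf \<Longrightarrow> smooth_map M (ip g X Y)"
  by (simp add: ip_fun_eq smooth_map_inner)

lemma ip_commute: "X \<in> vf \<Longrightarrow> Y \<in> vf \<Longrightarrow> ip g X Y = ip g Y X"
  by (simp add: ip_fun_eq inner_commute)

text \<open>Apply flatness to \<open>f\<close> itself, whose derivative along a field is
  \<open>push\<close>, and write the bracket through the torsion-free connection.\<close>

lemma push_nab_diff: "X \<in> vf \<Longrightarrow> Y \<in> vf \<Longrightarrow> P (nab X Y) - P (nab Y X) = D X (P Y) - D Y (P X)"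
  using flat_conn_lie_bracket[of X Y f] by (simp add: nab_torsion_free flat_conn_push push_diff)

text \<open>Koszul's argument: the defect between \<open>\<nabla>\<close> and the tangential part of the flat connection is symmetric in
  its first two and skew in its last two arguments.\<close>

lemma push_nab_inner:
  assumes "X \<in> vf" "Y \<in> vf" "Z \<in> vf"
  shows "P (nab X Y) p \<bullet> P Z p = D X (P Y) p \<bullet> P Z p"
proof -
  let ?c = "\<lambda>X Y Z. (P (nab X Y) p - D X (P Y) p) \<bullet> P Z p"
  have "?c X Y Z = 0"
  proof (rule skew_symmetric_zero[OF _ _ assms, of ?c])
    fix X Y Z assume *: "X \<in> vf" "Y \<in> vf" "Z \<in> vf"
    have "P (nab X Y) - D X (P Y) = P (nab Y X) - D Y (P X)"
      using push_nab_diff[OF *(1,2)] by (simp add: algebra_simps)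
    from fun_cong[OF this, of p] show "?c X Y Z = ?c Y X Z" by simp
    show "?c X Y Z = - ?c X Z Y"
      using nab_metric[OF *, of p] flat_conn_inner[of X "P Y" "P Z" p] *
      by (simp add: ip_fun_eq inner_diff_left inner_diff_right inner_commute)
  qed
  then show ?thesis by (simp add: inner_diff_left)
qed

lemma gauss_formula:
  assumes "X \<in> vf" "Y \<in> vf"
  shows "\<alpha> X Y \<in> ns" "D X (P Y) = P (nab X Y) + \<alpha> X Y"
proof -
  obtain W where W: "W \<in> vf" "\<alpha> X Y \<in> ns" "D X (P Y) = P W + \<alpha> X Y"
    unfolding second_ff_def by (rule normal_part_decompose[of "D X (P Y)"]) (use assms in auto)
  have "nab X Y = W"
    using assms W by (intro vector_field_eqI) (auto simp: push_nab_inner inner_add_left)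
  with W show "\<alpha> X Y \<in> ns" "D X (P Y) = P (nab X Y) + \<alpha> X Y" by auto
qed

declare gauss_formula(1) [simp]

lemma second_ff_sym:
  assumes "X \<in> vf" "Y \<in> vf"
  shows "\<alpha> X Y = \<alpha> Y X"
  using push_nab_diff[OF assms] gauss_formula(2)[OF assms] gauss_formula(2)[OF assms(2,1)]
  by (simp add: algebra_simps)

lemma shape_op_eq:
  assumes "W \<in> vf" "X \<in> vf" "\<And>Y p. Y \<in> vf \<Longrightarrow> P W p \<bullet> P Y p = b X Y p \<bullet> \<eta> p"
  shows "shape_op M g b \<eta> X = W"
  unfolding shape_op_def using assms by (intro the_vector_field) (auto simp: ip_eq)

text \<open>Differentiating the orthogonality of \<open>\<eta>\<close> and \<open>P Y\<close> and
  inserting the Gauss formula identifies the tangential part.\<close>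

lemma weingarten_formula:
  assumes "X \<in> vf" "\<eta> \<in> ns"
  shows "A \<eta> X \<in> vf" "nconn X \<eta> \<in> ns" "D X \<eta> = nconn X \<eta> - P (A \<eta> X)"
proof -
  obtain W where W: "W \<in> vf" "nconn X \<eta> \<in> ns" "D X \<eta> = P W + nconn X \<eta>"
    unfolding normal_conn_def by (rule normal_part_decompose[of "D X \<eta>"]) (use assms in auto)
  have "A \<eta> X = - W"
  proof (rule shape_op_eq)
    fix Y p assume Y: "Y \<in> vf"
    have "D X \<eta> p \<bullet> P Y p + \<eta> p \<bullet> D X (P Y) p = 0"
      using flat_conn_inner[of X \<eta> "P Y" p] tangent_const[of "X p" p 0] assms Y by simp
    then show "P (- W) p \<bullet> P Y p = \<alpha> X Y p \<bullet> \<eta> p"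
      using assms Y W by (simp add: push_uminus gauss_formula(2) inner_add_left inner_add_right inner_commute)
  qed (use assms W in \<open>auto intro: vector_fields_uminus\<close>)
  with W push_uminus[of W] show "A \<eta> X \<in> vf" "nconn X \<eta> \<in> ns" "D X \<eta> = nconn X \<eta> - P (A \<eta> X)"
    by (auto intro: vector_fields_uminus)
qed

declare weingarten_formula(1,2) [simp]

section \<open>Second derivatives and the Gauss and Codazzi equations\<close>

definition hess :: "'a vfield \<Rightarrow> 'a vfield \<Rightarrow> ('a \<Rightarrow> real ^ 'm) \<Rightarrow> 'a \<Rightarrow> real ^ 'm" where
  "hess X Y V = D X (D Y V) - D (nab X Y) V"

lemma hess_sym: "X \<in> vf \<Longrightarrow> Y \<in> vf \<Longrightarrow> hess X Y V = hess Y X V"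
  using flat_conn_lie_bracket[of X Y V] 
  by (simp add: hess_def nab_torsion_free flat_conn_diff_field algebra_simps)

lemma hess_push:
  assumes "X \<in> vf" "Y \<in> vf" "Z \<in> vf"
  shows "hess X Y (P Z) = P (nab X (nab Y Z) - A (\<alpha> Y Z) X - nab (nab X Y) Z)
    + (\<alpha> X (nab Y Z) + nconn X (\<alpha> Y Z) - \<alpha> (nab X Y) Z)"
  using assms
  by (simp add: hess_def gauss_formula(2) weingarten_formula(3) flat_conn_add push_diff push_add algebra_simps)

lemma hess_normal:
  assumes "X \<in> vf" "Y \<in> vf" "\<eta> \<in> ns"
  shows "hess X Y \<eta> = P (A \<eta> (nab X Y) - A (nconn Y \<eta>) X - nab X (A \<eta> Y))
    + (nconn X (nconn Y \<eta>) - \<alpha> X (A \<eta> Y) - nconn (nab X Y) \<eta>)"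
  using assms
  by (simp add: hess_def gauss_formula(2) weingarten_formula(3) flat_conn_diff push_diff push_add algebra_simps)

text \<open>The tangential part of \<open>hess_sym\<close> for \<open>P Z\<close>. Instead of a
  curvature tensor, each side keeps the exact expression to which \<open>L\<close> is applied in
  \<open>hess_L\<close>; likewise \<open>codazzi_equation\<close> matches the argument of
  \<open>\<Y>\<close> there.\<close>

lemma gauss_equation:
  assumes "X \<in> vf" "Y \<in> vf" "Z \<in> vf"
  shows "nab X (nab Y Z) - A (\<alpha> Y Z) X - nab (nab X Y) Z = nab Y (nab X Z) - A (\<alpha> X Z) Y - nab (nab Y X) Z"
  by (rule decomposition_unique(1)[OF hess_sym[OF assms(1,2), of "P Z", unfolded hess_push[OF assms] hess_push[OF assms(2,1,3)]]])
     (use assms in auto)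

lemma codazzi_equation:
  assumes "X \<in> vf" "Y \<in> vf" "Z \<in> vf"
  shows "\<alpha> X (nab Y Z) + nconn X (\<alpha> Y Z) - \<alpha> (nab X Y) Z = \<alpha> Y (nab X Z) + nconn Y (\<alpha> X Z) - \<alpha> (nab Y X) Z"
  by (rule decomposition_unique(2)[OF hess_sym[OF assms(1,2), of "P Z", unfolded hess_push[OF assms] hess_push[OF assms(2,1,3)]]])
     (use assms in auto)

text \<open>The tangential part of \<open>hess_sym\<close> for \<open>\<eta>\<close>, grouped as the
  argument of \<open>L\<close> in \<open>hess_Y\<close>.\<close>

lemma codazzi_equation_shape_op:
  assumes "X \<in> vf" "Y \<in> vf" "\<eta> \<in> ns"
  shows "A \<eta> (nab X Y) - A (nconn Y \<eta>) X - nab X (A \<eta> Y) = A \<eta> (nab Y X) - A (nconn X \<eta>) Y - nab Y (A \<eta> X)"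
  by (rule decomposition_unique(1)[OF hess_sym[OF assms(1,2), of \<eta>, unfolded hess_normal[OF assms] hess_normal[OF assms(2,1,3)]]])
     (use assms in auto)

end

section \<open>The operators of a bending and their first derivatives\<close>

locale conformally_bent = levi_civita_immersion M g f nab
  for M :: "('a::{t2_space,second_countable_topology}, 'n::finite) atlas"
    and g :: "'a metric" and f :: "'a \<Rightarrow> real ^ 'm::finite" and nab :: "'a connection" +
  fixes \<rho> :: "'a \<Rightarrow> real" and \<T> :: "'a \<Rightarrow> real ^ 'm"
  assumes bending: "conformal_bending M g f \<rho> \<T>"
begin

abbreviation "L \<equiv> bend_L f \<rho> \<T>"
abbreviation "\<Y> \<equiv> bend_Y M g f \<rho> \<T>"
abbreviation "\<beta> \<equiv> bend_beta M nab f \<rho> \<T>"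
abbreviation "\<E> \<equiv> bend_E M g f \<rho> \<T>"
abbreviation "B \<equiv> shape_op M g \<beta>"
abbreviation "grad \<equiv> gradient M g \<rho>"

lemma smooth_bending [simp]: "smooth_map M \<rho>" "smooth_map M \<T>"
  using bending by (auto simp: conformal_bending_def)

lemma smooth_L [simp]: "X \<in> vf \<Longrightarrow> smooth_map M (L X)"
  by (simp add: bend_L_def)

lemma L_diff: "L (X - Y) = L X - L Y"
  by (auto simp: bend_L_def flat_conn_diff_field push_diff sec_mult_def scaleR_diff_right)

lemma L_add: "L (X + Y) = L X + L Y"
  by (auto simp: bend_L_def flat_conn_add_field push_add sec_mult_def scaleR_add_right)

text \<open>Subtracting \<open>\<rho>\<close> times the differential of \<open>f\<close> removes
  exactly the conformal term of the bending equation.\<close>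

lemma L_skew:
  assumes "X \<in> vf" "Y \<in> vf"
  shows "L X p \<bullet> P Y p + L Y p \<bullet> P X p = 0"
proof -
  have "D X \<T> p \<bullet> P Y p + P X p \<bullet> D Y \<T> p = 2 * \<rho> p * ip g X Y p"
    using bending assms by (simp add: conformal_bending_def)
  then show ?thesis using assms by (simp add: bend_L_def sec_mult_def ip_eq algebra_simps inner_commute)
qed

text \<open>The differentials of \<open>\<T>\<close> and \<open>f\<close> have symmetric second
  derivatives, so only derivatives of \<open>\<rho>\<close> survive.\<close>

lemma L_exterior_derivative:
  assumes "X \<in> vf" "Y \<in> vf"
  shows "D X (L Y) - L (nab X Y) - (D Y (L X) - L (nab Y X)) =
     sec_mult (\<lambda>p. Y p \<rho>) (P X) - sec_mult (\<lambda>p. X p \<rho>) (P Y)"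
proof -
  have "D X (D Y \<T>) - D Y (D X \<T>) = D (nab X Y) \<T> - D (nab Y X) \<T>"
    using flat_conn_lie_bracket[of X Y \<T>] assms by (simp add: nab_torsion_free flat_conn_diff_field)
  moreover have "sec_mult \<rho> (P (nab X Y)) - sec_mult \<rho> (P (nab Y X)) = sec_mult \<rho> (D X (P Y)) - sec_mult \<rho> (D Y (P X))"
    using push_nab_diff[OF assms] by (auto simp: sec_mult_def fun_eq_iff scaleR_diff_right[symmetric])
  ultimately show ?thesis
    using assms by (simp add: bend_L_def flat_conn_diff flat_conn_sec_mult algebra_simps)
qed

text \<open>On normal sections \<open>L X\<close> may be replaced by \<open>D X \<T>\<close>, so the
  field representing \<open>\<eta>\<close> against \<open>\<T>\<close> exists; the sign in the
  defining relation makes \<open>\<Y> \<eta>\<close> its negative.\<close>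

lemma bend_Y:
  assumes "\<eta> \<in> ns"
  shows "\<Y> \<eta> \<in> vf" "X \<in> vf \<Longrightarrow> P (\<Y> \<eta>) p \<bullet> P X p = - (\<eta> p \<bullet> L X p)"
proof -
  have L: "\<eta> p \<bullet> L X p = \<eta> p \<bullet> D X \<T> p" if "X \<in> vf" for X p
    using that assms by (simp add: bend_L_def sec_mult_def inner_diff_right)
  obtain W where W: "W \<in> vf" "\<forall>p. \<forall>u\<in>tangent_space M p. vderiv (W p) f \<bullet> vderiv u f = \<eta> p \<bullet> vderiv u \<T>"
    using vector_field_representing[of \<eta> \<T>] assms by auto
  have PW: "P (- W) p \<bullet> P X p = - (\<eta> p \<bullet> L X p)" if "X \<in> vf" for X p
    using W(2) that by (simp add: L push_uminus) (simp add: push_def flat_conn_def)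
  have "\<Y> \<eta> = - W"
    unfolding bend_Y_def using W PW
    by (intro the_vector_field) (auto simp: ip_eq vector_fields_uminus add_eq_0_iff)
  then show "\<Y> \<eta> \<in> vf" "X \<in> vf \<Longrightarrow> P (\<Y> \<eta>) p \<bullet> P X p = - (\<eta> p \<bullet> L X p)"
    using W PW by (auto simp: vector_fields_uminus)
qed

declare bend_Y(1) [simp]

lemma bend_Y_commuted: "\<eta> \<in> ns \<Longrightarrow> X \<in> vf \<Longrightarrow> P X p \<bullet> P (\<Y> \<eta>) p = - (L X p \<bullet> \<eta> p)"
  using bend_Y(2)[of \<eta> X p] by (simp add: inner_commute)

lemma bend_Y_add: "\<xi> \<in> ns \<Longrightarrow> \<eta> \<in> ns \<Longrightarrow> \<Y> (\<xi> + \<eta>) = \<Y> \<xi> + \<Y> \<eta>"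
  by (rule vector_field_eqI) (auto simp: bend_Y(2) push_add inner_add_left)

lemma bend_Y_diff: "\<xi> \<in> ns \<Longrightarrow> \<eta> \<in> ns \<Longrightarrow> \<Y> (\<xi> - \<eta>) = \<Y> \<xi> - \<Y> \<eta>"
  using bend_Y_add[of "\<xi> - \<eta>" \<eta>] by simp

lemma gradient: 
  shows "grad \<in> vf" "X \<in> vf \<Longrightarrow> P grad p \<bullet> P X p = X p \<rho>"
proof -
  obtain W where W: "W \<in> vf" "\<forall>p. \<forall>u\<in>tangent_space M p. vderiv (W p) f \<bullet> vderiv u f = u \<rho>"
    using gradient_exists[of \<rho>] by auto
  then have PW: "P W p \<bullet> P X p = X p \<rho>" if "X \<in> vf" for X p
    using that by (simp add: push_def)
  have "grad = W"
    unfolding gradient_def using W PW by (intro the_vector_field) (auto simp: ip_eq)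
  then show "grad \<in> vf" "X \<in> vf \<Longrightarrow> P grad p \<bullet> P X p = X p \<rho>"
    using W PW by auto
qed

declare gradient(1) [simp]

lemma gradient_commuted: "X \<in> vf \<Longrightarrow> P X p \<bullet> P grad p = X p \<rho>"
  using gradient(2)[of X p] by (simp add: inner_commute)

lemma ip_gradient: "X \<in> vf \<Longrightarrow> ip g grad X = (\<lambda>p. X p \<rho>)"
  by (simp add: ip_fun_eq gradient(2))

text \<open>Metric compatibility for the gradient and \<open>Z\<close>: the Hessian of
  \<open>\<rho>\<close> is the inner product of \<open>nab X grad\<close> with \<open>Z\<close>.
  This brings H into the first equation.\<close>

lemma deriv_field_rho:
  "X \<in> vf \<Longrightarrow> Z \<in> vf \<Longrightarrow> X p (\<lambda>q. Z q \<rho>) = ip g (nab X grad) Z p + nab X Z p \<rho>"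
  using nab_metric[of X grad Z p] by (simp add: ip_gradient)

text \<open>The tangential part of \<open>D X (L Y) - L (nab X Y)\<close>. The term with
  \<open>grad\<close> makes the \<open>\<rho>\<close> terms, paired with \<open>Z\<close>, skew in
  \<open>Y\<close> and \<open>Z\<close>.\<close>

definition defect :: "'a vfield \<Rightarrow> 'a vfield \<Rightarrow> 'a vfield" where
  "defect X Y = \<Y> (\<alpha> X Y) + fmult (\<lambda>p. Y p \<rho>) X - fmult (ip g X Y) grad"

lemma defect_vf [simp]: "X \<in> vf \<Longrightarrow> Y \<in> vf \<Longrightarrow> defect X Y \<in> vf"
  by (simp add: defect_def)

lemma push_defect: "P (defect X Y) = P (\<Y> (\<alpha> X Y)) + sec_mult (\<lambda>p. Y p \<rho>) (P X) - sec_mult (ip g X Y) (P grad)"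
  by (simp add: defect_def push_diff push_add push_fmult)

text \<open>Koszul's argument again: the difference of the two sides is symmetric in
  \<open>X\<close>, \<open>Y\<close> by \<open>L_exterior_derivative\<close> and skew in
  \<open>Y\<close>, \<open>Z\<close> by differentiating \<open>L_skew\<close>.\<close>

lemma covariant_L_inner:
  assumes "X \<in> vf" "Y \<in> vf" "Z \<in> vf"
  shows "(D X (L Y) p - L (nab X Y) p) \<bullet> P Z p = P (defect X Y) p \<bullet> P Z p"
proof -
  let ?c = "\<lambda>X Y Z. (D X (L Y) p - L (nab X Y) p - P (defect X Y) p) \<bullet> P Z p"
  have "?c X Y Z = 0"
  proof (rule skew_symmetric_zero[OF _ _ assms, of ?c])
    fix X Y Z assume *: "X \<in> vf" "Y \<in> vf" "Z \<in> vf"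
    have "D X (L Y) - L (nab X Y) - P (defect X Y) = D Y (L X) - L (nab Y X) - P (defect Y X)"
      using L_exterior_derivative[OF *(1,2)] ip_commute[OF *(1,2)] second_ff_sym[OF *(1,2)]
      by (simp add: push_defect algebra_simps)
    from fun_cong[OF this, of p] show "?c X Y Z = ?c Y X Z" by simp
    have skew: "L X p \<bullet> P Y p = - (L Y p \<bullet> P X p)" if "X \<in> vf" "Y \<in> vf" for X Y
      using L_skew[OF that, of p] by simp
    have "D X (L Y) p \<bullet> P Z p + L Y p \<bullet> D X (P Z) p + D X (L Z) p \<bullet> P Y p + L Z p \<bullet> D X (P Y) p = 0"
      by (rule flat_conn_inner_const[of _ _ _ _ _ 0]) (use * L_skew in auto)
    \<comment> \<open>The Gauss formula splits the derivatives of \<open>P Y\<close> and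
      \<open>P Z\<close>: tangential parts are moved by skewness of \<open>L\<close>, normal parts
      become \<open>\<Y>\<close> terms.\<close>
    then have "D X (L Y) p \<bullet> P Z p - L (nab X Y) p \<bullet> P Z p + D X (L Z) p \<bullet> P Y p - L (nab X Z) p \<bullet> P Y p
        = P (\<Y> (\<alpha> X Z)) p \<bullet> P Y p + P (\<Y> (\<alpha> X Y)) p \<bullet> P Z p"
      using * by (simp add: gauss_formula(2) bend_Y(2) bend_Y_commuted inner_add_right skew[of Y "nab X Z"] skew[of Z "nab X Y"] inner_commute)
    then show "?c X Y Z = - ?c X Z Y"
      using * by (simp add: push_defect sec_mult_def ip_eq gradient(2) gradient_commuted inner_diff_left inner_diff_right inner_add_left inner_add_right inner_commute)
  qed
  then show ?thesis by (simp add: inner_diff_left)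
qed

lemma covariant_L:
  assumes "X \<in> vf" "Y \<in> vf"
  shows "\<beta> X Y \<in> ns" "D X (L Y) = L (nab X Y) + \<beta> X Y + P (defect X Y)"
proof -
  obtain W where W: "W \<in> vf" "\<beta> X Y \<in> ns" "D X (L Y) - L (nab X Y) = P W + \<beta> X Y"
    unfolding bend_beta_def by (rule normal_part_decompose[of "D X (L Y) - L (nab X Y)"]) (use assms in auto)
  have "defect X Y = W"
  proof (rule vector_field_eqI)
    fix Z p assume Z: "Z \<in> vf"
    show "P (defect X Y) p \<bullet> P Z p = P W p \<bullet> P Z p"
      using covariant_L_inner[OF assms Z, of p] fun_cong[OF W(3), of p] W(1,2) Z by (simp add: inner_add_left)
  qed (use assms W in auto)
  with W show "\<beta> X Y \<in> ns" "D X (L Y) = L (nab X Y) + \<beta> X Y + P (defect X Y)"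
    by (auto simp: algebra_simps)
qed

declare covariant_L(1) [simp]

text \<open>The antisymmetric part of the derivative of \<open>L\<close> is tangential and is
  already accounted for by the two defects.\<close>

lemma bend_beta_sym:
  assumes "X \<in> vf" "Y \<in> vf"
  shows "\<beta> X Y = \<beta> Y X"
  using L_exterior_derivative[OF assms] covariant_L(2)[OF assms] covariant_L(2)[OF assms(2,1)]
    ip_commute[OF assms] second_ff_sym[OF assms]
  by (simp add: push_defect algebra_simps)

text \<open>The tangential part comes from differentiating the relation between \<open>\<Y>\<close>
  and \<open>L\<close>. The normal part is \<open>\<alpha> X (\<Y> \<eta>)\<close>, which is
  \<open>\<E> X \<eta>\<close> less the normal part of \<open>L (A \<eta> X)\<close>; subtracting
  all of \<open>L (A \<eta> X)\<close> leaves its tangential part \<open>P W\<close> to be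
  compensated.\<close>

lemma covariant_Y:
  assumes "X \<in> vf" "\<eta> \<in> ns"
  shows "B \<eta> X \<in> vf" "\<E> X \<eta> \<in> ns"
    "D X (P (\<Y> \<eta>)) = P (\<Y> (nconn X \<eta>)) - L (A \<eta> X) + \<E> X \<eta> - P (B \<eta> X)"
proof -
  let ?LA = "normal_part M f (L (A \<eta> X))"
  obtain W where W: "W \<in> vf" "?LA \<in> ns" "L (A \<eta> X) = P W + ?LA"
    by (rule normal_part_decompose[of "L (A \<eta> X)"]) (use assms in auto)
  show E: "\<E> X \<eta> \<in> ns" using assms W by (simp add: bend_E_def)
  have B: "B \<eta> X = \<Y> (nconn X \<eta>) - W - nab X (\<Y> \<eta>)"
  proof (rule shape_op_eq)
    fix Y p assume Y: "Y \<in> vf"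
    have "D X (L Y) p \<bullet> \<eta> p + L Y p \<bullet> D X \<eta> p + D X (P (\<Y> \<eta>)) p \<bullet> P Y p + P (\<Y> \<eta>) p \<bullet> D X (P Y) p = 0"
      by (rule flat_conn_inner_const[of _ _ _ _ _ 0]) (use assms Y in \<open>auto simp: bend_Y(2) bend_Y_commuted inner_commute\<close>)
    moreover have "L (A \<eta> X) p \<bullet> P Y p = P W p \<bullet> P Y p"
      using fun_cong[OF W(3), of p] W(2) Y by (simp add: inner_add_left)
    ultimately show "P (\<Y> (nconn X \<eta>) - W - nab X (\<Y> \<eta>)) p \<bullet> P Y p = \<beta> X Y p \<bullet> \<eta> p"
      using assms Y L_skew[OF Y, of "A \<eta> X" p]
      by (simp add: covariant_L(2) weingarten_formula(3) gauss_formula(2) push_diff bend_Y(2) bend_Y_commuted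
          inner_add_left inner_add_right inner_diff_left inner_diff_right inner_commute)
  qed (use assms W in auto)
  show "B \<eta> X \<in> vf" using assms W by (simp add: B)
  show "D X (P (\<Y> \<eta>)) = P (\<Y> (nconn X \<eta>)) - L (A \<eta> X) + \<E> X \<eta> - P (B \<eta> X)"
    using assms W(1) by (subst W(3)) (simp add: B gauss_formula(2) bend_E_def push_add push_diff algebra_simps)
qed

declare covariant_Y(1,2) [simp]

section \<open>Second derivatives of the bending operators and the three equations\<close>

text \<open>Grouped in four: an \<open>L\<close> term and a \<open>\<Y>\<close> term, symmetric in
  \<open>X\<close> and \<open>Y\<close> by the Gauss and Codazzi equations, then a tangential and a
  normal remainder to be compared.\<close>

lemma hess_L:
  assumes "X \<in> vf" "Y \<in> vf" "Z \<in> vf"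
  shows "hess X Y (L Z) =
      L (nab X (nab Y Z) - A (\<alpha> Y Z) X - nab (nab X Y) Z)
    + P (\<Y> (\<alpha> X (nab Y Z) + nconn X (\<alpha> Y Z) - \<alpha> (nab X Y) Z))
    + (P (fmult (\<lambda>p. nab Y Z p \<rho>) X - fmult (ip g X (nab Y Z)) grad - A (\<beta> Y Z) X - B (\<alpha> Y Z) X
          + fmult (\<lambda>p. X p (\<lambda>q. Z q \<rho>)) Y - fmult (\<lambda>p. X p (ip g Y Z)) grad
          - fmult (ip g Y Z) (nab X grad) + fmult (ip g (nab X Y) Z) grad)
      + (\<beta> X (nab Y Z) + nconn X (\<beta> Y Z) - \<beta> (nab X Y) Z + \<E> X (\<alpha> Y Z)
          + sec_mult (\<lambda>p. Z p \<rho>) (\<alpha> X Y) - sec_mult (ip g Y Z) (\<alpha> X grad)))"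
proof -
  have add: "sec_mult c (V + W) = sec_mult c V + sec_mult c W" for c and V W :: "'a \<Rightarrow> real ^ 'm"
    by (auto simp: sec_mult_def scaleR_add_right)
  \<comment> \<open>The Gauss formula is supplied only for the fields \<open>Y\<close> and
    \<open>grad\<close>, so that derivatives of \<open>\<Y>\<close> terms are expanded by
    \<open>covariant_Y\<close>.\<close>
  show ?thesis
    using assms
    by (simp add: hess_def covariant_L(2) push_defect covariant_Y(3) weingarten_formula(3)
        gauss_formula(2)[of X Y] gauss_formula(2)[of X grad]
        flat_conn_add flat_conn_diff flat_conn_sec_mult add push_add push_diff push_fmult L_add L_diff
        bend_Y_add bend_Y_diff algebra_simps)
qed

lemma hess_Y:
  assumes "X \<in> vf" "Y \<in> vf" "\<eta> \<in> ns"
  shows "hess X Y (P (\<Y> \<eta>)) =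
      L (A \<eta> (nab X Y) - A (nconn Y \<eta>) X - nab X (A \<eta> Y))
    + (P (\<Y> (nconn X (nconn Y \<eta>)) - B (nconn Y \<eta>) X - defect X (A \<eta> Y) - A (\<E> Y \<eta>) X - nab X (B \<eta> Y)
          - \<Y> (nconn (nab X Y) \<eta>) + B \<eta> (nab X Y))
      + (\<E> X (nconn Y \<eta>) - \<beta> X (A \<eta> Y) + nconn X (\<E> Y \<eta>) - \<alpha> X (B \<eta> Y) - \<E> (nab X Y) \<eta>))"
  using assms
  by (simp add: hess_def covariant_L(2) covariant_Y(3) weingarten_formula(3) gauss_formula(2)[of X "B \<eta> Y"]
      flat_conn_add flat_conn_diff push_add push_diff L_add L_diff algebra_simps)

lemma fundamental_equations:
  assumes X: "X \<in> vf" and Y: "Y \<in> vf" and Z: "Z \<in> vf" and \<eta>: "\<eta> \<in> ns"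
  shows "A (\<beta> Y Z) X + B (\<alpha> Y Z) X - A (\<beta> X Z) Y - B (\<alpha> X Z) Y
       + (wedge g X (nab Y grad) Z - wedge g Y (nab X grad) Z) = 0"
    and "cov_deriv_form M nab f \<beta> X Y Z - cov_deriv_form M nab f \<beta> Y X Z
       = \<E> Y (\<alpha> X Z) - \<E> X (\<alpha> Y Z) + sec_mult (ip g Y Z) (\<alpha> X grad) - sec_mult (ip g X Z) (\<alpha> Y grad)"
    and "cov_deriv_mixed M nab f \<E> X Y \<eta> - cov_deriv_mixed M nab f \<E> Y X \<eta>
       = \<beta> X (A \<eta> Y) - \<beta> (A \<eta> X) Y + \<alpha> X (B \<eta> Y) - \<alpha> (B \<eta> X) Y"
proof -
  let ?T = "\<lambda>X Y. fmult (\<lambda>p. nab Y Z p \<rho>) X - fmult (ip g X (nab Y Z)) grad - A (\<beta> Y Z) X - B (\<alpha> Y Z) X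
          + fmult (\<lambda>p. X p (\<lambda>q. Z q \<rho>)) Y - fmult (\<lambda>p. X p (ip g Y Z)) grad
          - fmult (ip g Y Z) (nab X grad) + fmult (ip g (nab X Y) Z) grad"
  let ?N = "\<lambda>X Y. \<beta> X (nab Y Z) + nconn X (\<beta> Y Z) - \<beta> (nab X Y) Z + \<E> X (\<alpha> Y Z)
          + sec_mult (\<lambda>p. Z p \<rho>) (\<alpha> X Y) - sec_mult (ip g Y Z) (\<alpha> X grad)"
  \<comment> \<open>Once the Gauss and Codazzi equations are rewritten, the \<open>L\<close> and
    \<open>\<Y>\<close> terms of the two sides coincide and cancel.\<close>
  have eq: "P (?T X Y) + ?N X Y = P (?T Y X) + ?N Y X"
    using hess_sym[OF X Y, of "L Z"]
    unfolding hess_L[OF X Y Z] hess_L[OF Y X Z] gauss_equation[OF X Y Z] codazzi_equation[OF X Y Z]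
    by (simp only: add_left_cancel)
  have vf: "?T X Y \<in> vf" if "X \<in> vf" "Y \<in> vf" for X Y
    using that Z by simp
  have ns: "?N X Y \<in> ns" if "X \<in> vf" "Y \<in> vf" for X Y
    using that Z by simp
  note TN = decomposition_unique[OF eq vf[OF X Y] vf[OF Y X] ns[OF X Y] ns[OF Y X]]
  show "A (\<beta> Y Z) X + B (\<alpha> Y Z) X - A (\<beta> X Z) Y - B (\<alpha> X Z) Y
       + (wedge g X (nab Y grad) Z - wedge g Y (nab X grad) Z) = 0"
  \<comment> \<open>Evaluated at a point and a function, the tangential identity is real arithmetic:
    \<open>nab_metric\<close> makes the coefficient of \<open>grad\<close> symmetric in
    \<open>X\<close> and \<open>Y\<close>, and \<open>deriv_field_rho\<close> produces the wedge
    terms.\<close>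
  proof (intro ext)
    fix p h
    show "(A (\<beta> Y Z) X + B (\<alpha> Y Z) X - A (\<beta> X Z) Y - B (\<alpha> X Z) Y
       + (wedge g X (nab Y grad) Z - wedge g Y (nab X grad) Z)) p h = (0 :: 'a vfield) p h"
      using fun_cong[OF fun_cong[OF TN(1), of p], of h] X Y Z
        fun_cong[OF ip_commute[of X "nab Y Z"], of p] fun_cong[OF ip_commute[of Y "nab X Z"], of p]
      by (simp add: fmult_def wedge_def nab_metric deriv_field_rho algebra_simps)
  qed
  show "cov_deriv_form M nab f \<beta> X Y Z - cov_deriv_form M nab f \<beta> Y X Z
       = \<E> Y (\<alpha> X Z) - \<E> X (\<alpha> Y Z) + sec_mult (ip g Y Z) (\<alpha> X grad) - sec_mult (ip g X Z) (\<alpha> Y grad)"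
    \<comment> \<open>The term with \<open>Z p \<rho>\<close> cancels by symmetry of
      \<open>\<alpha>\<close>; the terms \<open>\<beta> X (nab Y Z)\<close> and
      \<open>\<beta> Y (nab X Z)\<close> complete the covariant derivatives.\<close>
    using TN(2) by (simp add: cov_deriv_form_def second_ff_sym[OF X Y] algebra_simps)
  let ?T' = "\<lambda>X Y. \<Y> (nconn X (nconn Y \<eta>)) - B (nconn Y \<eta>) X - defect X (A \<eta> Y) - A (\<E> Y \<eta>) X - nab X (B \<eta> Y)
          - \<Y> (nconn (nab X Y) \<eta>) + B \<eta> (nab X Y)"
  let ?N' = "\<lambda>X Y. \<E> X (nconn Y \<eta>) - \<beta> X (A \<eta> Y) + nconn X (\<E> Y \<eta>) - \<alpha> X (B \<eta> Y) - \<E> (nab X Y) \<eta>"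
  have "P (?T' X Y) + ?N' X Y = P (?T' Y X) + ?N' Y X"
    using hess_sym[OF X Y, of "P (\<Y> \<eta>)"]
    unfolding hess_Y[OF X Y \<eta>] hess_Y[OF Y X \<eta>] codazzi_equation_shape_op[OF X Y \<eta>]
    by (simp only: add_left_cancel)
  then have "?N' X Y = ?N' Y X"
    by (rule decomposition_unique(2)) (use X Y \<eta> in auto)
  then show "cov_deriv_mixed M nab f \<E> X Y \<eta> - cov_deriv_mixed M nab f \<E> Y X \<eta>
       = \<beta> X (A \<eta> Y) - \<beta> (A \<eta> X) Y + \<alpha> X (B \<eta> Y) - \<alpha> (B \<eta> X) Y"
    \<comment> \<open>Symmetry of \<open>\<beta>\<close> and \<open>\<alpha>\<close> brings the
      shape operator terms in \<open>X\<close> to the front as in the claim.\<close>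
    using X Y \<eta> by (simp add: cov_deriv_mixed_def bend_beta_sym[of "A \<eta> X" Y] second_ff_sym[of "B \<eta> X" Y] algebra_simps)
qed

end

theorem proposition5:
  fixes M :: "('a::{t2_space,second_countable_topology}, 'n::finite) atlas"
    and g :: "'a metric" and nab :: "'a connection"
    and f \<T> :: "'a \<Rightarrow> real ^ 'm::finite" and \<rho> :: "'a \<Rightarrow> real"
  assumes "smooth_atlas M"
    and "riemannian_metric M g"
    and "levi_civita M g nab"
    and "isometric_immersion M g f"
    and "conformal_bending M g f \<rho> \<T>"
    and "X \<in> vector_fields M" and "Y \<in> vector_fields M" and "Z \<in> vector_fields M"
    and "\<eta> \<in> normal_sections M f"
  shows "let \<alpha> = second_ff M f; \<beta> = bend_beta M nab f \<rho> \<T>; \<E> = bend_E M g f \<rho> \<T>;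
             A = shape_op M g \<alpha>; B = shape_op M g \<beta>;
             H = (\<lambda>X. nab X (gradient M g \<rho>));
             D\<beta> = cov_deriv_form M nab f \<beta>; D\<E> = cov_deriv_mixed M nab f \<E>
         in
           A (\<beta> Y Z) X + B (\<alpha> Y Z) X - A (\<beta> X Z) Y - B (\<alpha> X Z) Y
             + (wedge g X (H Y) Z - wedge g Y (H X) Z) = 0
         \<and> D\<beta> X Y Z - D\<beta> Y X Z
             = \<E> Y (\<alpha> X Z) - \<E> X (\<alpha> Y Z)
               + sec_mult (ip g Y Z) (\<alpha> X (gradient M g \<rho>))
               - sec_mult (ip g X Z) (\<alpha> Y (gradient M g \<rho>))
         \<and> D\<E> X Y \<eta> - D\<E> Y X \<eta>
             = \<beta> X (A \<eta> Y) - \<beta> (A \<eta> X) Y + \<alpha> X (B \<eta> Y) - \<alpha> (B \<eta> X) Y"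
proof -
  interpret conformally_bent M g f nab \<rho> \<T>
    by unfold_locales fact+
  show ?thesis
    using fundamental_equations[OF assms(6-9)] by (simp only: Let_def simp_thms)
qed

end
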